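(* Let $a$, $b$, $c$ and $z$ be complex numbers such that $z\notin(-\infty,0]$, and such that each of $a$, $c-a$, $b$, $c-b$ and $c$ is admissible (i.e. is neither $0$ nor a negative integer). Then $$ \frac{\Gamma(a)\,\Gamma(c-a)\,\Gamma(b)\,\Gamma(c-b)}{\Gamma(c)}\,F(a,b;c;1-z) = \frac{1}{2\pi i}\int_{-i\infty}^{i\infty}\Gamma(a+s)\,\Gamma(b+s)\,\Gamma(c-a-b-s)\,\Gamma(-s)\,z^s\,ds, $$ where the integration path $L$ from $-i\infty$ to $i\infty$ separates the poles $s=-a-n$ and $s=-b-n$ $(n=0,1,2,\dots)$, which lie on the left of $L$, from the poles $s=n$ and $s=c-a-b+n$ $(n=0,1,2,\dots)$, which lie on the right of $L$.
   Context: A complex number $\xi$ is called admissible if it is neither $0$ nor a negative integer. For a complex number $\xi$, put $(\xi)_0=1$ and $(\xi)_n=\xi(\xi+1)\cdots(\xi+n-1)$ for $n=1,2,\dots$. $\Gamma$ denotes the Euler gamma function, extended meromorphically to $\mathbb{C}$. For $c$ admissible, $F(a,b;c;z)$ denotes the Gauss hypergeometric function, defined for $|z|<1$ by $$F(a,b;c;z)=\sum_{k=0}^\infty \frac{(a)_k (b)_k}{k!\,(c)_k}z^k$$ and extended to the analytic function on $\mathbb{C}\setminus[1,\infty)$ that is the analytic continuation of this series. (Equivalently, when $a,b,c$ are admissible and $z\notin[0,\infty)$, it is given by $$\frac{\Gamma(a)\Gamma(b)}{\Gamma(c)}F(a,b;c;z)=\frac{1}{2\pi i}\int_{-i\infty}^{i\infty}\frac{\Gamma(a+s)\Gamma(b+s)\Gamma(-s)}{\Gamma(c+s)}(-z)^s\,ds$$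 with $|\arg(-z)|<\pi$ and a path separating the poles $s=-a-n$, $s=-b-n$ on its left from the poles $s=0,1,2,\dots$ on its right.) For $z\notin(-\infty,0]$, $z^s=\exp(s\log z)$ with the principal branch of the logarithm ($|\arg z|<\pi$). The path of integration $L$ is the imaginary axis, oriented from $-i\infty$ to $i\infty$, curved (in a bounded region) if necessary so that it separates the poles as prescribed. *)

theory Defs
  imports "HOL-Complex_Analysis.Complex_Analysis"
begin

text \<open>
  Admissibility of a complex number \<open>\<xi>\<close> is written \<open>\<xi> \<notin> \<int>\<^sub>\<le>\<^sub>0\<close>, the shifted factorial
  \<open>(\<xi>)\<^sub>n\<close> is \<open>pochhammer \<xi> n\<close>, and \<open>z\<^sup>s\<close> (principal branch) is \<open>z powr s\<close>.
\<close>

text \<open>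
  The analytic continuation of the Gauss series to the plane cut along \<open>[1, \<infinity>)\<close>. The cut plane
  is connected, so the conditions determine the function uniquely there; on the cut its values
  are unspecified.
\<close>

definition gauss_F :: "complex \<Rightarrow> complex \<Rightarrow> complex \<Rightarrow> complex \<Rightarrow> complex" where
  "gauss_F a b c = (SOME f.
     f holomorphic_on (- of_real ` {1::real..}) \<and>
     (\<forall>w. norm w < 1 \<longrightarrow>
       (\<lambda>k. pochhammer a k * pochhammer b k / (fact k * pochhammer c k) * w ^ k) sums f w))"

text \<open>
  A path from \<open>-\<i>\<infinity>\<close> to \<open>\<i>\<infinity>\<close>, parametrized by the whole real line, which is the imaginary axis
  except for a bounded part where it may be deformed. Regularity is that of \<^const>\<open>valid_path\<close>.
\<close>

definition deformed_imag_axis :: "(real \<Rightarrow> complex) \<Rightarrow> bool" where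
  "deformed_imag_axis L \<longleftrightarrow>
     (\<exists>R>0. L piecewise_C1_differentiable_on {-R..R} \<and>
            (\<forall>t. R \<le> \<bar>t\<bar> \<longrightarrow> L t = \<i> * of_real t))"

text \<open>
  The sides of such an upward path are the components of its complement that contain all real
  numbers near \<open>-\<infinity>\<close> and near \<open>\<infinity>\<close>, respectively. In particular a point on either side does not
  lie on the path.
\<close>

definition left_of :: "(real \<Rightarrow> complex) \<Rightarrow> complex \<Rightarrow> bool" where
  "left_of L p \<longleftrightarrow> (\<forall>\<^sub>F x in at_bot. connected_component (- range L) p (of_real x))"

definition right_of :: "(real \<Rightarrow> complex) \<Rightarrow> complex \<Rightarrow> bool" where
  "right_of L p \<longleftrightarrow> (\<forall>\<^sub>F x in at_top. connected_component (- range L) p (of_real x))"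

text \<open>
  The analogues of \<^const>\<open>has_contour_integral\<close> etc. for paths parametrized by the whole real line.
  The gauge integral over the line includes improper integrals.
\<close>

definition line_integrable_on :: "(complex \<Rightarrow> complex) \<Rightarrow> (real \<Rightarrow> complex) \<Rightarrow> bool" where
  "line_integrable_on f L \<longleftrightarrow> (\<lambda>t. f (L t) * vector_derivative L (at t)) integrable_on UNIV"

definition line_integral :: "(real \<Rightarrow> complex) \<Rightarrow> (complex \<Rightarrow> complex) \<Rightarrow> complex" where
  "line_integral L f = integral UNIV (\<lambda>t. f (L t) * vector_derivative L (at t))"

end

theory Submission
  imports Defs
begin

text \<open>
  Write \<open>d = c - a - b\<close> and \<open>\<Phi>(s) = \<Gamma>(a+s) \<Gamma>(b+s) \<Gamma>(d-s) \<Gamma>(e-s)\<close> with \<open>e = 0\<close>, so that the integrand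
  is \<open>\<Phi>(s) z\<^sup>s\<close>. Expanding \<open>z\<^sup>s\<close> by the binomial series at \<open>z = 1\<close> turns \<open>\<Gamma>(-s)\<close> into \<open>\<Gamma>(k-s)\<close>,
  so that the Taylor coefficients of the integral are given by Barnes' first lemma
  and are those of the Gauss series in \<open>1 - z\<close>. The same expansion at an arbitrary point of
  the slit plane shows that the integral is holomorphic there, and the identity theorem concludes.

  The path may fail to be rectifiable, so nothing can be estimated on it directly. Since
  \<open>(a+s) + (d-s) = a+d\<close>, the kernel \<open>\<Phi>\<close> is a linear combination of kernels with \<open>a\<close> or \<open>d\<close> raised
  by one, and similarly for the other pairs. Iterating this on the given path one may assume that
  \<open>a+d\<close>, \<open>a+e\<close>, \<open>b+d\<close>, \<open>b+e\<close> all have positive real part. Then some vertical line separates the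
  poles as well, and Cauchy's theorem moves the integral to this line.

  On a vertical line Barnes' first lemma follows from a recurrence in \<open>d\<close>, obtained by
  translating the line by 1, together with the asymptotics for \<open>d + n\<close>, \<open>n \<rightarrow> \<infinity>\<close>.
\<close>


section \<open>The Gamma function in vertical strips\<close>

text \<open>\<open>piecewise_C1_differentiable_on\<close> asks for a continuous derivative only off
  a finite set and lets it blow up there, so the given path may have infinite length. On it only
  linearity of the integral and Cauchy's theorem are used; every estimate of the kernel in a strip
  is made on vertical lines. There the constants must fit together. Up to powers of t each Gamma
  factor decays like exp(-pi/2 |t|); this is weakened to rate 3/2, and then to rate 1 to absorb the
  powers, so the kernel has rate 4. Against this, |z^s| grows at a rate of at most pi < 13/4, and
  for |w| <= 1/3 the binomial series is dominated at the cost of exp(|s|/2). The total 13/4 + 1/2 =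
  15/4 stays below 4. The admissibility of a, b, c - a, c - b says that the cross sums a + e, b + e,
  b + d, a + d are admissible for e = 0, so no divisor met while raising parameters vanishes. A
  general e is kept for the symmetry of the kernel and because e = k yields the k-th Taylor
  coefficient at 1.\<close>

lemma norm_pochhammer_quotient:
  fixes x y :: real
  assumes "0 < x"
  shows "norm (Gamma_series' (Complex x y) n) / Gamma_series' x n =
         (\<Prod>k<n. (x + real k) / norm (Complex (x + real k) y))"
proof -
  have "norm (exp (Complex x y * of_real (ln (real n)))) = exp (x * ln (real n))"
    by simp
  moreover have "norm (pochhammer (Complex x y) n) = (\<Prod>k<n. norm (Complex (x + real k) y))"
  proof -
    have eq: "Complex x y + of_nat k = Complex (x + real k) y" for k
      by (simp add: complex_eq_iff)
    show ?thesis
      by (simp add: pochhammer_prod prod_norm[symmetric] atLeast0LessThan eq del: complex_norm)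
  qed
  moreover have "pochhammer x n = (\<Prod>k<n. x + real k)"
    by (simp add: pochhammer_prod atLeast0LessThan)
  moreover have "fact (n - 1) * exp (x * ln (real n)) \<noteq> 0" by simp
  ultimately show ?thesis
    by (simp add: Gamma_series'_def norm_mult norm_divide prod_dividef del: complex_norm)
qed

text \<open>By Gauss's limit formula: in \<open>Gamma_series'\<close> the factorial and the modulus
  n^x of n^(x + iy) cancel in the quotient. The remaining factors are at most 1 and increase with x;
  these two facts give \<open>norm_Gamma_le_Gamma_Re\<close> and
  \<open>norm_Gamma_quotient_mono\<close>.\<close>

lemma norm_Gamma_quotient_tendsto:
  fixes x y :: real
  assumes "0 < x"
  shows "(\<lambda>n. \<Prod>k<n. (x + real k) / norm (Complex (x + real k) y))
           \<longlonglongrightarrow> norm (Gamma (Complex x y)) / Gamma x"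
proof -
  have "Gamma x \<noteq> 0"
    using assms Gamma_real_pos[of x] by linarith
  then have "(\<lambda>n. norm (Gamma_series' (Complex x y) n) / Gamma_series' x n)
           \<longlonglongrightarrow> norm (Gamma (Complex x y)) / Gamma x"
    by (intro tendsto_intros Gamma_series'_LIMSEQ)
  then show ?thesis
    by (simp only: norm_pochhammer_quotient[OF assms])
qed

text \<open>Each factor u / |u + iy| of the limit product increases with u. This takes the place of
  Stirling's formula: a decay rate known on one vertical line passes to the lines between it and the
  imaginary axis.\<close>

lemma norm_Gamma_quotient_mono:
  fixes x x' y :: real
  assumes "0 < x" "x \<le> x'"
  shows "norm (Gamma (Complex x y)) / Gamma x \<le> norm (Gamma (Complex x' y)) / Gamma x'"
proof (rule LIMSEQ_le)
  have "u / norm (Complex u y) \<le> v / norm (Complex v y)" if "0 < u" "u \<le> v" for u v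
  proof -
    have "u\<^sup>2 * y\<^sup>2 \<le> v\<^sup>2 * y\<^sup>2" using that by (intro mult_right_mono power_mono) auto
    then have "(u * norm (Complex v y))\<^sup>2 \<le> (v * norm (Complex u y))\<^sup>2"
      by (simp add: power_mult_distrib cmod_power2 algebra_simps)
    then have "u * norm (Complex v y) \<le> v * norm (Complex u y)"
      using that by (simp add: power2_le_iff_abs_le abs_mult)
    moreover have "0 < norm (Complex u y)" "0 < norm (Complex v y)"
      using that by (auto simp: zero_less_norm_iff complex_eq_iff simp del: complex_norm)
    ultimately show ?thesis by (simp add: field_simps del: complex_norm)
  qed
  then show "\<exists>N. \<forall>n\<ge>N. (\<Prod>k<n. (x + real k) / norm (Complex (x + real k) y))
      \<le> (\<Prod>k<n. (x' + real k) / norm (Complex (x' + real k) y))"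
    using assms by (intro exI[of _ 0] allI impI prod_mono) auto
qed (use assms in \<open>auto intro!: norm_Gamma_quotient_tendsto simp del: complex_norm\<close>)

lemma norm_Gamma_le_Gamma_Re:
  assumes "0 < Re s"
  shows "norm (Gamma s) \<le> Gamma (Re s)"
proof -
  have "norm (Gamma (Complex (Re s) (Im s))) / Gamma (Re s) \<le> 1"
  proof (rule LIMSEQ_le_const2[OF norm_Gamma_quotient_tendsto])
    have "(Re s + real k) / norm (Complex (Re s + real k) (Im s)) \<le> 1" for k
    proof -
      have "\<bar>Re s + real k\<bar> \<le> norm (Complex (Re s + real k) (Im s))"
        using abs_Re_le_cmod[of "Complex (Re s + real k) (Im s)"] by simp
      then show ?thesis using assms by (intro divide_le_eq_1[THEN iffD2]) auto
    qed
    then show "\<exists>N. \<forall>n\<ge>N. (\<Prod>k<n. (Re s + real k) / norm (Complex (Re s + real k) (Im s))) \<le> 1"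
      using assms by (intro exI[of _ 0] allI impI prod_le_1) auto
  qed (use assms in auto)
  then show ?thesis
    using Gamma_real_pos[OF assms] by (simp add: field_simps)
qed

text \<open>On the line Re z = 1/2 the conjugate of z is 1 - z, so the reflection formula evaluates
  |Gamma z|^2 in closed form. The decay on other lines is derived from this one.\<close>

lemma norm_Gamma_half_sq:
  "(norm (Gamma (Complex (1/2) y)))\<^sup>2 = pi / cosh (pi * y)"
proof -
  let ?z = "Complex (1/2) y"
  have "cnj ?z = 1 - ?z" by (simp add: complex_eq_iff)
  then have "of_real ((norm (Gamma ?z))\<^sup>2) = Gamma ?z * Gamma (1 - ?z)"
    unfolding complex_norm_square by (metis cnj_Gamma)
  also have "\<dots> = of_real pi / sin (of_real pi * ?z)" by (rule Gamma_reflection_complex)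
  also have "of_real pi * ?z = of_real pi / 2 + \<i> * of_real (pi * y)"
    by (simp add: complex_eq_iff)
  also have "sin (of_real pi / 2 + \<i> * of_real (pi * y)) = cos (\<i> * of_real (pi * y))"
    by (simp add: sin_add)
  also have "\<dots> = of_real (cosh (pi * y))"
    by (simp add: cos_conv_cosh cosh_field_def exp_of_real[symmetric])
  finally show ?thesis
    by (simp flip: of_real_divide of_real_power)
qed

lemma norm_Gamma_half_le: "norm (Gamma (Complex (1/2) y)) \<le> 4 * exp (- (3/2) * \<bar>y\<bar>)"
proof -
  \<comment> \<open>The rate 3 < pi for |Gamma|^2 becomes 3/2 for |Gamma|.\<close>
  have "exp (3 * \<bar>y\<bar>) / 2 \<le> exp (\<bar>pi * y\<bar>) / 2"
    using pi_gt3 by (simp add: abs_mult mult_right_mono)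
  also have "\<dots> \<le> cosh \<bar>pi * y\<bar>" by (simp add: cosh_field_def)
  finally have "exp (3 * \<bar>y\<bar>) / 2 \<le> cosh (pi * y)" by simp
  then have "pi / cosh (pi * y) \<le> 4 / (exp (3 * \<bar>y\<bar>) / 2)"
    using pi_less_4 by (intro frac_le) auto
  also have "\<dots> = 8 * exp (- 3 * \<bar>y\<bar>)" by (simp add: exp_minus field_simps)
  also have "\<dots> \<le> (4 * exp (- (3/2) * \<bar>y\<bar>))\<^sup>2"
    by (simp add: power2_eq_square exp_add[symmetric] power_mult_distrib)
  finally show ?thesis
    unfolding norm_Gamma_half_sq[symmetric] by (rule power2_le_imp_le) simp
qed

lemma norm_Gamma_plus_nat_half_le:
  "\<exists>C\<ge>0. \<forall>y. norm (Gamma (Complex (1/2 + real m) y)) \<le> C * (1 + \<bar>y\<bar>) ^ m * exp (- (3/2) * \<bar>y\<bar>)"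
proof (induction m)
  case 0
  show ?case using norm_Gamma_half_le by (intro exI[of _ 4]) auto
next
  case (Suc m)
  then obtain C where C: "C \<ge> 0"
    "\<And>y. norm (Gamma (Complex (1/2 + real m) y)) \<le> C * (1 + \<bar>y\<bar>) ^ m * exp (- (3/2) * \<bar>y\<bar>)"
    by blast
  have "norm (Gamma (Complex (1/2 + real (Suc m)) y))
          \<le> (C * (1 + real m)) * (1 + \<bar>y\<bar>) ^ Suc m * exp (- (3/2) * \<bar>y\<bar>)" for y
  proof -
    let ?z = "Complex (1/2 + real m) y"
    have "?z \<notin> \<int>\<^sub>\<le>\<^sub>0"
      by (auto elim!: nonpos_Ints_cases simp: complex_eq_iff)
    then have "Gamma (?z + 1) = ?z * Gamma ?z" by (rule Gamma_plus1)
    moreover have "?z + 1 = Complex (1/2 + real (Suc m)) y" by (simp add: complex_eq_iff)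
    ultimately have "norm (Gamma (Complex (1/2 + real (Suc m)) y)) = norm ?z * norm (Gamma ?z)"
      by (metis norm_mult)
    also have "norm ?z \<le> (1/2 + real m) + \<bar>y\<bar>"
      using cmod_le[of ?z] by simp
    also have "\<dots> \<le> (1 + real m) * (1 + \<bar>y\<bar>)" by (simp add: algebra_simps)
    finally show ?thesis
      using C(2)[of y] C(1)
        mult_mono[of "(1 + real m) * (1 + \<bar>y\<bar>)" "(1 + real m) * (1 + \<bar>y\<bar>)" "norm (Gamma ?z)"
            "C * (1 + \<bar>y\<bar>) ^ m * exp (- (3/2) * \<bar>y\<bar>)"]
      by (simp add: mult_right_mono mult_ac del: complex_norm)
  qed
  then show ?case using C(1) by (intro exI[of _ "C * (1 + real m)"]) auto
qed

text \<open>The drop of the rate from 3/2 to 1 pays for the polynomial factor that the functional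
  equation brings in.\<close>

lemma power_mult_exp_bounded:
  "\<exists>C\<ge>0. \<forall>y::real. y \<ge> 0 \<longrightarrow> (1 + y) ^ m * exp (- (3/2) * y) \<le> C * exp (- y)"
proof -
  have "(1 + y) ^ m * exp (- (3/2) * y) \<le> (fact m * 2 ^ m * exp (1/2)) * exp (- y)" if "y \<ge> 0" for y :: real
  proof -
    \<comment> \<open>One term of the exponential series, taken at (1 + y) / 2 so that its growth
      exp(y/2) is exactly the difference of the two rates.\<close>
    have "((1 + y) / 2) ^ m / fact m \<le> exp ((1 + y) / 2)"
    proof -
      have "(\<lambda>n. ((1 + y) / 2) ^ n /\<^sub>R fact n) sums exp ((1 + y) / 2)"
        by (rule exp_converges)
      from sum_le_suminf[OF sums_summable[OF this], of "{m}"] show ?thesis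
        using that sums_unique[OF \<open>(\<lambda>n. ((1 + y) / 2) ^ n /\<^sub>R fact n) sums exp ((1 + y) / 2)\<close>]
        by (simp add: field_simps)
    qed
    then have "(1 + y) ^ m \<le> fact m * 2 ^ m * exp ((1 + y) / 2)"
      by (simp add: power_divide field_simps)
    then have "(1 + y) ^ m * exp (- (3/2) * y) \<le> fact m * 2 ^ m * exp ((1 + y) / 2) * exp (- (3/2) * y)"
      by (intro mult_right_mono) auto
    also have "\<dots> = (fact m * 2 ^ m * exp (1/2)) * exp (- y)"
      by (simp add: exp_add[symmetric] field_simps mult_exp_exp)
    finally show ?thesis .
  qed
  then show ?thesis by (intro exI[of _ "fact m * 2 ^ m * exp (1/2)"]) auto
qed

lemma Gamma_real_bounded_on:
  assumes "0 < u"
  shows "\<exists>B>0. \<forall>x\<in>{u..v}. Gamma x \<le> (B::real)"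
proof -
  have "continuous_on {u..v} (Gamma :: real \<Rightarrow> real)"
    using assms by (intro continuous_on_Gamma) (auto elim!: nonpos_Ints_cases)
  then have "bounded (Gamma ` {u..v} :: real set)"
    by (intro compact_imp_bounded compact_continuous_image) auto
  then obtain B where "B > 0" "\<forall>x\<in>Gamma ` {u..v}. norm x \<le> (B::real)"
    using bounded_pos by blast
  then show ?thesis by (intro exI[of _ B]) auto
qed

text \<open>The functional equation first moves s to the right by m > A, past the poles; for |Im s|
  >= 1 every factor of the Pochhammer product has modulus at least 1, so this can only increase the
  norm. The line Re = 1/2 + M lies further right, and monotonicity compares with it.\<close>

lemma norm_Gamma_strip:
  "\<exists>C\<ge>0. \<forall>s. \<bar>Re s\<bar> \<le> A \<longrightarrow> 1 \<le> \<bar>Im s\<bar> \<longrightarrow> norm (Gamma s) \<le> C * exp (- \<bar>Im s\<bar>)"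
proof -
  obtain m :: nat where m: "real m > A" using reals_Archimedean2 by blast
  obtain M :: nat where M: "real M > real m + A" using reals_Archimedean2 by blast
  obtain B where B: "B > 0" "\<forall>x\<in>{m - A..m + A}. Gamma x \<le> B"
    using Gamma_real_bounded_on[of "m - A" "m + A"] m by auto
  obtain C1 where C1: "C1 \<ge> 0"
    "\<And>y. norm (Gamma (Complex (1/2 + real M) y)) \<le> C1 * (1 + \<bar>y\<bar>) ^ M * exp (- (3/2) * \<bar>y\<bar>)"
    using norm_Gamma_plus_nat_half_le by blast
  obtain C2 where C2: "C2 \<ge> 0"
    "\<And>y::real. y \<ge> 0 \<Longrightarrow> (1 + y) ^ M * exp (- (3/2) * y) \<le> C2 * exp (- y)"
    using power_mult_exp_bounded by blast
  define G where "G = Gamma (1/2 + real M)"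
  have G: "G > 0" unfolding G_def by (intro Gamma_real_pos) auto
  have "norm (Gamma s) \<le> (B / G * C1 * C2) * exp (- \<bar>Im s\<bar>)" if s: "\<bar>Re s\<bar> \<le> A" "1 \<le> \<bar>Im s\<bar>" for s
  proof -
    have ns: "s \<notin> \<int>\<^sub>\<le>\<^sub>0" using s by (auto elim!: nonpos_Ints_cases)
    have "1 \<le> norm (pochhammer s m)"
    proof -
      have "1 \<le> norm (s + of_nat k)" for k
        using s(2) abs_Im_le_cmod[of "s + of_nat k"] by simp
      then show ?thesis by (simp add: pochhammer_prod prod_norm[symmetric] prod_ge_1)
    qed
    moreover have "norm (Gamma (s + of_nat m)) = norm (pochhammer s m) * norm (Gamma s)"
      using pochhammer_Gamma[OF ns, of m] ns by (simp add: norm_mult[symmetric] Gamma_eq_zero_iff)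
    ultimately have "norm (Gamma s) \<le> norm (Gamma (s + of_nat m))"
      using mult_right_mono[of 1 "norm (pochhammer s m)" "norm (Gamma s)"] by simp
    also have "s + of_nat m = Complex (Re s + real m) (Im s)" by (simp add: complex_eq_iff)
    also have "norm (Gamma (Complex (Re s + real m) (Im s)))
        \<le> Gamma (Re s + real m) * (norm (Gamma (Complex (1/2 + real M) (Im s))) / G)"
    proof -
      have "0 < Re s + real m" "Re s + real m \<le> 1/2 + real M" using s m M by auto
      from norm_Gamma_quotient_mono[OF this, of "Im s"] Gamma_real_pos[OF this(1)]
      show ?thesis by (simp add: G_def field_simps)
    qed
    also have "\<dots> \<le> B * (norm (Gamma (Complex (1/2 + real M) (Im s))) / G)"
    proof -
      have "Re s + real m \<in> {real m - A..real m + A}" using s(1) by (simp add: abs_le_iff)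
      then show ?thesis using B(2) G by (intro mult_right_mono) auto
    qed
    also have "\<dots> \<le> B * (C1 * (C2 * exp (- \<bar>Im s\<bar>)) / G)"
    proof -
      have "norm (Gamma (Complex (1/2 + real M) (Im s))) \<le> C1 * ((1 + \<bar>Im s\<bar>) ^ M * exp (- (3/2) * \<bar>Im s\<bar>))"
        using C1(2)[of "Im s"] by (simp add: mult_ac)
      also have "\<dots> \<le> C1 * (C2 * exp (- \<bar>Im s\<bar>))"
        using C1(1) C2(2)[of "\<bar>Im s\<bar>"] by (intro mult_left_mono) auto
      finally show ?thesis using B G by (intro mult_left_mono divide_right_mono) auto
    qed
    finally show ?thesis by (simp add: field_simps)
  qed
  moreover have "B / G * C1 * C2 \<ge> 0" using B G C1 C2 by auto
  ultimately show ?thesis by blast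
qed

lemma norm_Gamma_strip_shift:
  "\<exists>C\<ge>0. \<exists>Y. \<forall>s. \<bar>Re s\<bar> \<le> A \<longrightarrow> Y \<le> \<bar>Im s\<bar> \<longrightarrow>
     norm (Gamma (a + s)) \<le> C * exp (- \<bar>Im s\<bar>) \<and> norm (Gamma (a - s)) \<le> C * exp (- \<bar>Im s\<bar>)"
proof -
  obtain C where C: "C \<ge> 0" "\<And>s. \<bar>Re s\<bar> \<le> A + \<bar>Re a\<bar> \<Longrightarrow> 1 \<le> \<bar>Im s\<bar> \<Longrightarrow> norm (Gamma s) \<le> C * exp (- \<bar>Im s\<bar>)"
    using norm_Gamma_strip[of "A + \<bar>Re a\<bar>"] by blast
  have "norm (Gamma u) \<le> C * exp (\<bar>Im a\<bar>) * exp (- \<bar>Im s\<bar>)"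
    if "\<bar>Re s\<bar> \<le> A" "1 + \<bar>Im a\<bar> \<le> \<bar>Im s\<bar>" "u = a + s \<or> u = a - s" for s u
  proof -
    have "norm (Gamma u) \<le> C * exp (- \<bar>Im u\<bar>)"
      using that by (intro C(2)) auto
    also have "\<dots> \<le> C * exp (\<bar>Im a\<bar> - \<bar>Im s\<bar>)"
      using C(1) that by (intro mult_left_mono) auto
    finally show ?thesis by (simp add: exp_diff exp_minus field_simps)
  qed
  then show ?thesis
    using C(1) by (intro exI[of _ "C * exp \<bar>Im a\<bar>"] conjI exI[of _ "1 + \<bar>Im a\<bar>"]) auto
qed


section \<open>Integrals along vertical lines\<close>

lemma integrable_on_exp_abs:
  fixes \<kappa> :: real
  assumes "\<kappa> > 0"
  shows "(\<lambda>t. exp (- \<kappa> * \<bar>t\<bar>)) integrable_on UNIV"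
proof -
  define h where "h = (\<lambda>t::real. indicator {0..} t *\<^sub>R exp (- \<kappa> * t))"
  have "(\<lambda>t. exp (- \<kappa> * t)) absolutely_integrable_on {0..}"
    using integrable_on_exp_minus_to_infinity[OF assms, of 0]
    by (intro nonnegative_absolutely_integrable_1) auto
  then have "integrable lebesgue h"
    unfolding set_integrable_def h_def .
  moreover have "h \<in> borel_measurable lborel"
    unfolding h_def by (auto intro!: borel_measurable_continuous_on_indicator continuous_intros)
  ultimately have h: "integrable lborel h"
    by (simp add: integrable_completion)
  then have "integrable lborel (\<lambda>t. h (0 + (- 1) * t))"
    by (intro lborel_integrable_real_affine) auto
  with h have "integrable lborel (\<lambda>t. h t + h (0 + (- 1) * t))"
    by (intro Bochner_Integration.integrable_add)
  then have "(\<lambda>t. h t + h (0 + (- 1) * t)) integrable_on UNIV"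
    by (rule integrable_on_lborel)
  then show ?thesis
    by (rule integrable_spike_finite[of "{0}", rotated -1]) (auto simp: h_def indicator_def)
qed

lemma exp_decay_integrable_on:
  fixes f :: "real \<Rightarrow> complex"
  assumes "continuous_on S f" "S \<in> sets lebesgue" "\<kappa> > 0"
    and "\<And>t. t \<in> S \<Longrightarrow> norm (f t) \<le> C * exp (- \<kappa> * \<bar>t\<bar>)"
  shows "f integrable_on S"
proof (rule measurable_bounded_by_integrable_imp_integrable)
  show "f \<in> borel_measurable (lebesgue_on S)"
    using assms by (intro continuous_imp_measurable_on_sets_lebesgue)
  have "(\<lambda>t. \<bar>C\<bar> * exp (- \<kappa> * \<bar>t\<bar>)) absolutely_integrable_on UNIV"
    using integrable_on_mult_right[OF integrable_on_exp_abs[OF assms(3)], of "\<bar>C\<bar>"]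
    by (intro nonnegative_absolutely_integrable_1) auto
  then have "(\<lambda>t. \<bar>C\<bar> * exp (- \<kappa> * \<bar>t\<bar>)) absolutely_integrable_on S"
    using assms(2) by (rule set_integrable_subset) auto
  then show "(\<lambda>t. \<bar>C\<bar> * exp (- \<kappa> * \<bar>t\<bar>)) integrable_on S"
    using set_lebesgue_integral_eq_integral(1) by blast
  show "norm (f t) \<le> \<bar>C\<bar> * exp (- \<kappa> * \<bar>t\<bar>)" if "t \<in> S" for t
    using assms(4)[OF that] by (smt (verit) exp_gt_zero mult_right_mono)
qed (use assms in auto)

text \<open>The middle piece is merely assumed gauge integrable, because the bounded portion of a
  deformed path may admit no absolute bound; only the tails are dominated.\<close>

lemma exp_tails_integrable_on:
  fixes f :: "real \<Rightarrow> complex"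
  assumes "f integrable_on {- T..T}" "continuous_on {T..} f" "continuous_on {..- T} f"
    and "\<kappa> > 0" "T > 0" "\<And>t. T \<le> \<bar>t\<bar> \<Longrightarrow> norm (f t) \<le> C * exp (- \<kappa> * \<bar>t\<bar>)"
  shows "f integrable_on UNIV"
proof -
  have bd: "norm (f t) \<le> C * exp (- \<kappa> * \<bar>t\<bar>)" if "t \<in> {T..} \<or> t \<in> {..- T}" for t
    using that assms(5) by (intro assms(6)) auto
  have "f integrable_on {T..}"
    by (rule exp_decay_integrable_on[OF assms(2) _ assms(4) bd]) auto
  moreover have "f integrable_on {..- T}"
    by (rule exp_decay_integrable_on[OF assms(3) _ assms(4) bd]) auto
  moreover have "negligible ({- T..T} \<inter> {T..})"
    by (rule negligible_subset[of "{T}"]) auto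
  ultimately have "f integrable_on {..- T}" "f integrable_on {- T..}"
    using assms(1,5) by (auto intro!: integrable_Un'[of f "{- T..T}" "{T..}"])
  moreover have "negligible ({..- T} \<inter> {- T..})"
    by (rule negligible_subset[of "{- T}"]) auto
  ultimately show ?thesis
    by (rule integrable_Un') auto
qed

lemma symmetric_integral_tendsto:
  fixes f :: "real \<Rightarrow> complex"
  assumes "f integrable_on UNIV"
  shows "((\<lambda>T. integral {- T..T} f) \<longlongrightarrow> integral UNIV f) at_top"
proof (rule tendstoI)
  fix e :: real assume "e > 0"
  from assms have "(f has_integral integral UNIV f) UNIV" by (rule integrable_integral)
  with \<open>e > 0\<close> obtain B where B: "B > 0"
    "\<And>a b. ball 0 B \<subseteq> cbox a b \<Longrightarrow> norm (integral (cbox a b) f - integral UNIV f) < e"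
    unfolding has_integral_alt' by auto
  have "dist (integral {- T..T} f) (integral UNIV f) < e" if "T \<ge> B" for T
  proof -
    have "ball 0 B \<subseteq> cbox (- T) T" using that by (auto simp: dist_norm)
    from B(2)[OF this] show ?thesis by (simp add: dist_norm)
  qed
  then show "\<forall>\<^sub>F T in at_top. dist (integral {- T..T} f) (integral UNIV f) < e"
    by (auto simp: eventually_at_top_linorder)
qed

text \<open>Only large |Im s| counts, so functions with poles of bounded height qualify. The rate
  may depend on the width of the strip.\<close>

definition strip_decay :: "(complex \<Rightarrow> complex) \<Rightarrow> bool" where
  "strip_decay X \<longleftrightarrow> (\<forall>A. \<exists>\<kappa>>0. \<exists>C Y. \<forall>s. \<bar>Re s\<bar> \<le> A \<longrightarrow> Y \<le> \<bar>Im s\<bar> \<longrightarrow>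
     norm (X s) \<le> C * exp (- \<kappa> * \<bar>Im s\<bar>))"

lemma strip_decayD:
  assumes "strip_decay X"
  obtains \<kappa> C Y where "\<kappa> > 0" "C \<ge> 0" "Y > 0"
    "\<And>s. \<bar>Re s\<bar> \<le> A \<Longrightarrow> Y \<le> \<bar>Im s\<bar> \<Longrightarrow> norm (X s) \<le> C * exp (- \<kappa> * \<bar>Im s\<bar>)"
proof -
  obtain \<kappa> C Y where *: "\<kappa> > 0"
    "\<And>s. \<bar>Re s\<bar> \<le> A \<Longrightarrow> Y \<le> \<bar>Im s\<bar> \<Longrightarrow> norm (X s) \<le> C * exp (- \<kappa> * \<bar>Im s\<bar>)"
    using assms unfolding strip_decay_def by meson
  have "norm (X s) \<le> max C 0 * exp (- \<kappa> * \<bar>Im s\<bar>)" if "\<bar>Re s\<bar> \<le> A" "max Y 1 \<le> \<bar>Im s\<bar>" for s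
  proof -
    have "norm (X s) \<le> C * exp (- \<kappa> * \<bar>Im s\<bar>)" using *(2) that by auto
    also have "\<dots> \<le> max C 0 * exp (- \<kappa> * \<bar>Im s\<bar>)" by (intro mult_right_mono) auto
    finally show ?thesis .
  qed
  with *(1) show thesis by (intro that[of \<kappa> "max C 0" "max Y 1"]) auto
qed

text \<open>An integral in dt: the contour integral up the line is \<open>\<i>\<close> times
  this.\<close>

definition vertical_integral :: "real \<Rightarrow> (complex \<Rightarrow> complex) \<Rightarrow> complex" where
  "vertical_integral \<sigma> X = integral UNIV (\<lambda>t. X (Complex \<sigma> t))"

definition vertical_integrable :: "real \<Rightarrow> (complex \<Rightarrow> complex) \<Rightarrow> bool" where
  "vertical_integrable \<sigma> X \<longleftrightarrow> (\<lambda>t. X (Complex \<sigma> t)) integrable_on UNIV"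

lemma continuous_on_Complex_line [continuous_intros]: "continuous_on S (\<lambda>t. Complex \<sigma> t)"
  by (simp add: Complex_eq continuous_intros)

lemma continuous_on_vertical:
  assumes "continuous_on {s. Re s = \<sigma>} X"
  shows "continuous_on S (\<lambda>t. X (Complex \<sigma> t))"
  by (rule continuous_on_compose2[OF assms]) (auto intro!: continuous_intros)

lemma vertical_integrableI:
  assumes "strip_decay X" "continuous_on {s. Re s = \<sigma>} X"
  shows "vertical_integrable \<sigma> X"
proof -
  obtain \<kappa> C Y where *: "\<kappa> > 0" "C \<ge> 0" "Y > 0"
    "\<And>s. \<bar>Re s\<bar> \<le> \<bar>\<sigma>\<bar> \<Longrightarrow> Y \<le> \<bar>Im s\<bar> \<Longrightarrow> norm (X s) \<le> C * exp (- \<kappa> * \<bar>Im s\<bar>)"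
    using strip_decayD[OF assms(1), of "\<bar>\<sigma>\<bar>"] by blast
  show ?thesis unfolding vertical_integrable_def
    by (rule exp_tails_integrable_on[OF integrable_continuous_interval _ _ *(1) *(3)])
       (use *(4)[of "Complex \<sigma> t" for t] in \<open>auto intro: continuous_on_vertical[OF assms(2)]\<close>)
qed

lemma horizontal_integral_tendsto_0:
  assumes "strip_decay X" "\<delta> = 1 \<or> \<delta> = (- 1 :: real)"
  shows "((\<lambda>T. contour_integral (linepath (Complex x1 (\<delta> * T)) (Complex x2 (\<delta> * T))) X) \<longlongrightarrow> 0) at_top"
proof -
  define A where "A = max \<bar>x1\<bar> \<bar>x2\<bar>"
  obtain \<kappa> C Y where *: "\<kappa> > 0" "C \<ge> 0" "Y > 0"
    "\<And>s. \<bar>Re s\<bar> \<le> A \<Longrightarrow> Y \<le> \<bar>Im s\<bar> \<Longrightarrow> norm (X s) \<le> C * exp (- \<kappa> * \<bar>Im s\<bar>)"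
    using strip_decayD[OF assms(1), of A] by blast
  have bound: "norm (contour_integral (linepath (Complex x1 (\<delta> * T)) (Complex x2 (\<delta> * T))) X)
          \<le> C * exp (- \<kappa> * T) * \<bar>x2 - x1\<bar>" if "T \<ge> Y" for T
  proof (cases "X contour_integrable_on (linepath (Complex x1 (\<delta> * T)) (Complex x2 (\<delta> * T)))")
    case True
    have "norm (X s) \<le> C * exp (- \<kappa> * T)"
      if s: "s \<in> closed_segment (Complex x1 (\<delta> * T)) (Complex x2 (\<delta> * T))" for s
    proof -
      obtain u where u: "0 \<le> u" "u \<le> 1"
          "s = (1 - u) *\<^sub>R Complex x1 (\<delta> * T) + u *\<^sub>R Complex x2 (\<delta> * T)"
        using s by (auto simp: closed_segment_def)
      have "Im s = \<delta> * T" unfolding u(3) by (simp add: left_diff_distrib)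
      moreover have "Re s \<in> closed_segment x1 x2"
        using u by (auto simp: closed_segment_def)
      then have "\<bar>Re s\<bar> \<le> A"
        by (auto simp: closed_segment_eq_real_ivl A_def split: if_splits)
      ultimately show ?thesis using *(4)[of s] assms(2) \<open>T \<ge> Y\<close> *(3) by (auto simp: abs_mult)
    qed
    then have "norm (contour_integral (linepath (Complex x1 (\<delta> * T)) (Complex x2 (\<delta> * T))) X)
       \<le> C * exp (- \<kappa> * T) * norm (Complex x2 (\<delta> * T) - Complex x1 (\<delta> * T))"
      using True * by (intro contour_integral_bound_linepath) auto
    also have "norm (Complex x2 (\<delta> * T) - Complex x1 (\<delta> * T)) = \<bar>x2 - x1\<bar>"
      by (simp add: cmod_def)
    finally show ?thesis .
  next
    case False
    \<comment> \<open>\<open>contour_integral\<close> is 0 when the function is not integrable along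
      the path, so the bound holds in this case as well.\<close>
    then show ?thesis using * by (simp add: not_integrable_contour_integral)
  qed
  show ?thesis
  proof (rule Lim_null_comparison)
    show "\<forall>\<^sub>F T in at_top. norm (contour_integral (linepath (Complex x1 (\<delta> * T)) (Complex x2 (\<delta> * T))) X)
        \<le> C * exp (- \<kappa> * T) * \<bar>x2 - x1\<bar>"
      using eventually_ge_at_top[of Y] by eventually_elim (rule bound)
    show "((\<lambda>T. C * exp (- \<kappa> * T) * \<bar>x2 - x1\<bar>) \<longlongrightarrow> 0) at_top"
      using \<open>\<kappa> > 0\<close> by real_asymp
  qed
qed

lemma contour_integral_vertical:
  "T > 0 \<Longrightarrow> contour_integral (linepath (Complex \<sigma> (- T)) (Complex \<sigma> T)) X
       = \<i> * integral {- T..T} (\<lambda>t. X (Complex \<sigma> t))"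
  by (subst contour_integral_linepath_same_Re[where c = \<sigma> and a = "- T" and b = T]) auto

text \<open>Cauchy's integral formula for g on rectangles between the two lines, whose horizontal
  sides vanish in the limit. Counterclockwise the rectangle goes up at \<open>\<sigma>2\<close> and
  down at \<open>\<sigma>1\<close>, and the \<open>\<i>\<close> from ds = \<open>\<i>\<close> dt
  cancels the one in 2 pi \<open>\<i>\<close>.\<close>

lemma vertical_integral_residue:
  fixes g X :: "complex \<Rightarrow> complex"
  assumes lu: "l < \<sigma>1" "\<sigma>1 < Re e" "Re e < \<sigma>2" "\<sigma>2 < u"
    and hol: "g holomorphic_on {s. l < Re s \<and> Re s < u}"
    and X: "\<And>s. l < Re s \<Longrightarrow> Re s < u \<Longrightarrow> s \<noteq> e \<Longrightarrow> X s = g s / (s - e)"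
    and dec: "strip_decay X"
  shows "vertical_integral \<sigma>2 X - vertical_integral \<sigma>1 X = 2 * pi * g e"
proof -
  let ?S = "{s. l < Re s \<and> Re s < u}"
  have op: "open ?S"
    using open_Int[OF open_halfspace_Re_gt[of l] open_halfspace_Re_lt[of u]]
    by (simp add: Int_def)
  have cv: "convex ?S"
    using convex_Int[OF convex_halfspace_Re_gt[of l] convex_halfspace_Re_lt[of u]]
    by (simp add: Int_def)
  have eS: "e \<in> ?S" using lu by auto
  have holX: "X holomorphic_on (?S - {e})"
  proof (rule holomorphic_transform)
    show "(\<lambda>s. g s / (s - e)) holomorphic_on (?S - {e})"
      by (intro holomorphic_intros holomorphic_on_subset[OF hol]) auto
  qed (use X in auto)
  then have contX: "continuous_on K X" if "K \<subseteq> ?S - {e}" for K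
    using that by (meson continuous_on_subset holomorphic_on_imp_continuous_on)
  have int: "vertical_integrable \<sigma> X" if "\<sigma> = \<sigma>1 \<or> \<sigma> = \<sigma>2" for \<sigma>
    using that lu by (intro vertical_integrableI dec contX) auto
  have vt: "((\<lambda>T. contour_integral (linepath (Complex \<sigma> (- T)) (Complex \<sigma> T)) X)
      \<longlongrightarrow> \<i> * vertical_integral \<sigma> X) at_top" if "\<sigma> = \<sigma>1 \<or> \<sigma> = \<sigma>2" for \<sigma>
  proof (rule Lim_transform_eventually)
    show "((\<lambda>T. \<i> * integral {- T..T} (\<lambda>t. X (Complex \<sigma> t))) \<longlongrightarrow> \<i> * vertical_integral \<sigma> X) at_top"
      unfolding vertical_integral_def
      using int[OF that] unfolding vertical_integrable_def
      by (intro tendsto_intros symmetric_integral_tendsto)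
    show "\<forall>\<^sub>F T in at_top. \<i> * integral {- T..T} (\<lambda>t. X (Complex \<sigma> t)) =
            contour_integral (linepath (Complex \<sigma> (- T)) (Complex \<sigma> T)) X"
      using eventually_gt_at_top[of 0] by eventually_elim (simp add: contour_integral_vertical)
  qed
  have ht: "((\<lambda>T. contour_integral (linepath (Complex \<sigma>1 (\<delta> * T)) (Complex \<sigma>2 (\<delta> * T))) X) \<longlongrightarrow> 0) at_top"
    if "\<delta> = 1 \<or> \<delta> = - 1" for \<delta>
    using dec that by (rule horizontal_integral_tendsto_0)
  \<comment> \<open>The factors 1 and - 1 stay unsimplified so that both horizontal sides match
    \<open>ht\<close>.\<close>
  let ?lim = "\<lambda>T. contour_integral (linepath (Complex \<sigma>1 (- 1 * T)) (Complex \<sigma>2 (- 1 * T))) X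
     + contour_integral (linepath (Complex \<sigma>2 (- T)) (Complex \<sigma>2 T)) X
     - contour_integral (linepath (Complex \<sigma>1 (1 * T)) (Complex \<sigma>2 (1 * T))) X
     - contour_integral (linepath (Complex \<sigma>1 (- T)) (Complex \<sigma>1 T)) X"
  have lim: "(?lim \<longlongrightarrow> 0 + \<i> * vertical_integral \<sigma>2 X - 0 - \<i> * vertical_integral \<sigma>1 X) at_top"
    by (intro tendsto_intros vt ht) auto
  have ev: "\<forall>\<^sub>F T in at_top. ?lim T = 2 * pi * \<i> * g e"
    using eventually_gt_at_top[of "\<bar>Im e\<bar>"] eventually_gt_at_top[of 0]
  proof eventually_elim
    case (elim T)
    define R where "R = rectpath (Complex \<sigma>1 (- T)) (Complex \<sigma>2 T)"
    have boxe: "e \<in> box (Complex \<sigma>1 (- T)) (Complex \<sigma>2 T)"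
      using elim lu by (auto simp: in_box_complex_iff)
    have pR: "path_image R \<subseteq> ?S - {e}"
      using path_image_rectpath_cbox_minus_box[of "Complex \<sigma>1 (- T)" "Complex \<sigma>2 T"] boxe elim lu
      unfolding R_def by (auto simp: in_cbox_complex_iff in_box_complex_iff)
    have "((\<lambda>w. g w / (w - e)) has_contour_integral (2 * pi * \<i> * winding_number R e * g e)) R"
      using eS pR op by (intro Cauchy_integral_formula_convex_simple[OF cv hol])
        (auto simp: R_def interior_open)
    then have "((\<lambda>w. g w / (w - e)) has_contour_integral (2 * pi * \<i> * g e)) R"
      using winding_number_rectpath[OF boxe] by (simp add: R_def)
    then have "(X has_contour_integral (2 * pi * \<i> * g e)) R"
    proof (rule has_contour_integral_eq)
      show "g w / (w - e) = X w" if "w \<in> path_image R" for w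
        using subsetD[OF pR that] X[of w] by auto
    qed
    then have *: "contour_integral R X = 2 * pi * \<i> * g e"
      by (rule contour_integral_unique)
    have seg: "X contour_integrable_on linepath p q" if "closed_segment p q \<subseteq> path_image R" for p q
      using that pR by (intro contour_integrable_continuous_linepath contX) (rule order_trans)
    have Req: "R = linepath (Complex \<sigma>1 (- T)) (Complex \<sigma>2 (- T)) +++
        linepath (Complex \<sigma>2 (- T)) (Complex \<sigma>2 T) +++
        linepath (Complex \<sigma>2 T) (Complex \<sigma>1 T) +++ linepath (Complex \<sigma>1 T) (Complex \<sigma>1 (- T))"
      by (simp add: R_def rectpath_def Let_def)
    have PI: "path_image R = closed_segment (Complex \<sigma>1 (- T)) (Complex \<sigma>2 (- T)) \<union>
        closed_segment (Complex \<sigma>2 (- T)) (Complex \<sigma>2 T) \<union>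
        closed_segment (Complex \<sigma>2 T) (Complex \<sigma>1 T) \<union> closed_segment (Complex \<sigma>1 T) (Complex \<sigma>1 (- T))"
      unfolding Req by (simp add: path_image_join Un_assoc)
    have ints: "X contour_integrable_on linepath (Complex \<sigma>1 (- T)) (Complex \<sigma>2 (- T))"
        "X contour_integrable_on linepath (Complex \<sigma>2 (- T)) (Complex \<sigma>2 T)"
        "X contour_integrable_on linepath (Complex \<sigma>2 T) (Complex \<sigma>1 T)"
        "X contour_integrable_on linepath (Complex \<sigma>1 T) (Complex \<sigma>1 (- T))"
      by (rule seg, unfold PI, blast)+
    have reverse: "contour_integral (linepath (Complex \<sigma>2 T) (Complex \<sigma>1 T)) X
         = - contour_integral (linepath (Complex \<sigma>1 T) (Complex \<sigma>2 T)) X"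
       "contour_integral (linepath (Complex \<sigma>1 T) (Complex \<sigma>1 (- T))) X
         = - contour_integral (linepath (Complex \<sigma>1 (- T)) (Complex \<sigma>1 T)) X"
      using contour_integral_reversepath[of "linepath (Complex \<sigma>1 T) (Complex \<sigma>2 T)" X]
        contour_integral_reversepath[of "linepath (Complex \<sigma>1 (- T)) (Complex \<sigma>1 T)" X] by auto
    show ?case
      using * ints unfolding Req by (simp add: reverse add_diff_eq)
  qed
  have "((\<lambda>_::real. 2 * pi * \<i> * g e) \<longlongrightarrow> 0 + \<i> * vertical_integral \<sigma>2 X - 0 - \<i> * vertical_integral \<sigma>1 X) at_top"
    using lim ev by (rule Lim_transform_eventually)
  then have "2 * pi * \<i> * g e = \<i> * vertical_integral \<sigma>2 X - \<i> * vertical_integral \<sigma>1 X"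
    by (simp add: tendsto_const_iff)
  then have "\<i> * (vertical_integral \<sigma>2 X - vertical_integral \<sigma>1 X) = \<i> * (2 * pi * g e)"
    by (simp add: algebra_simps)
  then show ?thesis by simp
qed

lemma vertical_integral_shift:
  assumes "l < \<sigma>1" "\<sigma>1 < \<sigma>2" "\<sigma>2 < u"
    and "X holomorphic_on {s. l < Re s \<and> Re s < u}" "strip_decay X"
  shows "vertical_integral \<sigma>2 X = vertical_integral \<sigma>1 X"
proof -
  \<comment> \<open>An arbitrary point between the lines serves as a removable pole: with g s = (s -
    e) * X s the residue g e is 0.\<close>
  define e where "e = Complex ((\<sigma>1 + \<sigma>2) / 2) 0"
  have "vertical_integral \<sigma>2 X - vertical_integral \<sigma>1 X = 2 * pi * ((e - e) * X e)"
    using assms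
    by (intro vertical_integral_residue[where l = l and u = u and g = "\<lambda>s. (s - e) * X s"])
      (auto intro!: holomorphic_intros simp: e_def)
  then show ?thesis by simp
qed


section \<open>From the deformed imaginary axis to a vertical line\<close>

lemma deformed_imag_axisE:
  assumes "deformed_imag_axis L"
  obtains R T0 where "0 < R" "R < T0" "\<And>t. R \<le> \<bar>t\<bar> \<Longrightarrow> L t = Complex 0 t"
    "\<And>t. \<bar>t\<bar> \<le> R \<Longrightarrow> norm (L t) < T0"
    "\<And>T. R \<le> T \<Longrightarrow> L piecewise_C1_differentiable_on {- T..T}"
proof -
  obtain R where R: "R > 0" "L piecewise_C1_differentiable_on {- R..R}"
    "\<And>t. R \<le> \<bar>t\<bar> \<Longrightarrow> L t = \<i> * of_real t"
    using assms unfolding deformed_imag_axis_def by blast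
  have "compact (L ` {- R..R})"
    using R(2) by (intro compact_continuous_image) (auto simp: piecewise_C1_differentiable_on_def)
  then obtain B where B: "B > 0" "\<forall>w\<in>L ` {- R..R}. norm w \<le> B"
    using compact_imp_bounded bounded_pos by blast
  have "L piecewise_C1_differentiable_on {- T..T}" if "R \<le> T" for T
  proof -
    let ?ax = "\<lambda>t. \<i> * complex_of_real t"
    have ax: "?ax piecewise_C1_differentiable_on S" for S
      by (intro C1_differentiable_imp_piecewise derivative_intros)
    have "(\<lambda>t. if t \<le> - R then ?ax t else if t \<le> R then L t else ?ax t)
            piecewise_C1_differentiable_on {- T..T}"
      using R that by (intro piecewise_C1_differentiable_cases ax) auto
    also have "(\<lambda>t. if t \<le> - R then ?ax t else if t \<le> R then L t else ?ax t) = L"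
      using R by auto
    finally show ?thesis .
  qed
  moreover have "L t = Complex 0 t" if "R \<le> \<bar>t\<bar>" for t
    using R(3)[OF that] by (simp add: complex_eq_iff)
  moreover have "norm (L t) < B + R + 1" if "\<bar>t\<bar> \<le> R" for t
  proof -
    have "norm (L t) \<le> B" using that B(2) by (auto simp: abs_le_iff)
    then show ?thesis using R(1) by simp
  qed
  ultimately show thesis using R(1) B(1) by (intro that[of R "B + R + 1"]) auto
qed

definition truncated_path :: "(real \<Rightarrow> complex) \<Rightarrow> real \<Rightarrow> real \<Rightarrow> complex" where
  "truncated_path L T = (\<lambda>u. L (2 * T * u - T))"

lemma truncated_path_image:
  assumes "T > 0"
  shows "path_image (truncated_path L T) = L ` {- T..T}"
proof -
  have "(\<lambda>u. 2 * T * u - T) ` {0..1} = {- T..T}"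
    using image_affinity_atLeastAtMost[of "2 * T" "- T" 0 1] assms by (simp add: algebra_simps)
  then show ?thesis
    unfolding path_image_def truncated_path_def by (metis image_image)
qed

lemma pathstart_truncated_path [simp]: "pathstart (truncated_path L T) = L (- T)"
  and pathfinish_truncated_path [simp]: "pathfinish (truncated_path L T) = L T"
  by (simp_all add: truncated_path_def pathstart_def pathfinish_def)

lemma valid_path_truncated_path:
  assumes "T > 0" "L piecewise_C1_differentiable_on {- T..T}"
  shows "valid_path (truncated_path L T)"
proof -
  have "(\<lambda>u. 2 * T * u + - T) ` {0..1} = {- T..T}"
    using image_affinity_atLeastAtMost[of "2 * T" "- T" 0 1] assms(1) by (simp add: algebra_simps)
  then have "(L \<circ> (\<lambda>u. (2 * T) *\<^sub>R u + - T)) piecewise_C1_differentiable_on {0..1}"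
    using assms(2) by (intro piecewise_C1_differentiable_affine) simp
  then show ?thesis by (simp add: valid_path_def truncated_path_def o_def)
qed

text \<open>An affine substitution, which the gauge integral permits without absolute integrability;
  the finitely many points where \<open>L\<close> may lack a derivative are ignored.\<close>

lemma truncated_path_has_integral:
  assumes T: "T > 0" and L: "L piecewise_C1_differentiable_on {- T..T}"
    and I: "(X has_contour_integral I) (truncated_path L T)"
  shows "((\<lambda>t. X (L t) * vector_derivative L (at t)) has_integral I) {- T..T}"
proof -
  obtain F where F: "finite F" "L C1_differentiable_on ({- T..T} - F)"
    using L by (auto simp: piecewise_C1_differentiable_on_def)
  let ?G = "\<lambda>u. X (truncated_path L T u) * vector_derivative (truncated_path L T) (at u)"
  have "(?G has_integral I) (cbox 0 1)"
    using I unfolding has_contour_integral by simp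
  from has_integral_affinity'[OF this, of "1 / (2 * T)" "1 / 2"] T
  have "((\<lambda>t. ?G (t / (2 * T) + 1 / 2)) has_integral (2 * T) *\<^sub>R I) {- T..T}"
    by (simp add: field_simps)
  then have "((\<lambda>t. (1 / (2 * T)) *\<^sub>R ?G (t / (2 * T) + 1 / 2)) has_integral (1 / (2 * T)) *\<^sub>R (2 * T) *\<^sub>R I) {- T..T}"
    by (rule has_integral_cmul)
  then have *: "((\<lambda>t. (1 / (2 * T)) *\<^sub>R ?G (t / (2 * T) + 1 / 2)) has_integral I) {- T..T}"
    using T by simp
  show ?thesis
  proof (rule has_integral_spike_finite[OF F(1) _ *])
    fix t assume t: "t \<in> {- T..T} - F"
    let ?u = "t / (2 * T) + 1 / 2"
    have u: "2 * T * ?u - T = t" using T by (simp add: field_simps)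
    have "L differentiable at t" using F(2) t by (auto simp: C1_differentiable_on_eq)
    then have "(L has_vector_derivative vector_derivative L (at t)) (at (2 * T * ?u - T))"
      unfolding u using vector_derivative_works by blast
    moreover have "((\<lambda>u. 2 * T * u - T) has_vector_derivative 2 * T) (at ?u)"
      by (auto intro!: derivative_eq_intros)
    ultimately have "(L \<circ> (\<lambda>u. 2 * T * u - T) has_vector_derivative (2 * T) *\<^sub>R vector_derivative L (at t)) (at ?u)"
      by (intro vector_diff_chain_at)
    then have "vector_derivative (truncated_path L T) (at ?u) = (2 * T) *\<^sub>R vector_derivative L (at t)"
      unfolding truncated_path_def o_def by (rule vector_derivative_at)
    moreover have "truncated_path L T ?u = L t" unfolding truncated_path_def u ..
    ultimately show "X (L t) * vector_derivative L (at t) = (1 / (2 * T)) *\<^sub>R ?G ?u"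
      using T by simp
  qed
qed

text \<open>Runs downwards along Re = \<open>\<sigma>\<close>, so that Cauchy's theorem for the
  closed loop equates, as T grows, the integral along \<open>L\<close> with the one up the vertical
  line.\<close>

definition closing_path :: "real \<Rightarrow> real \<Rightarrow> real \<Rightarrow> complex" where
  "closing_path \<sigma> T = linepath (Complex 0 T) (Complex \<sigma> T) +++
     linepath (Complex \<sigma> T) (Complex \<sigma> (- T)) +++ linepath (Complex \<sigma> (- T)) (Complex 0 (- T))"

lemma closing_path_simps [simp]:
  "pathstart (closing_path \<sigma> T) = Complex 0 T"
  "pathfinish (closing_path \<sigma> T) = Complex 0 (- T)"
  "valid_path (closing_path \<sigma> T)"
  by (simp_all add: closing_path_def)

text \<open>The product in the third claim expresses, for either sign of \<open>\<sigma>\<close>,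
  that the path never enters the side of the imaginary axis opposite to
  \<open>\<sigma>\<close>.\<close>

lemma path_image_closing_path:
  assumes "w \<in> path_image (closing_path \<sigma> T)" "T > 0"
  shows "\<bar>Im w\<bar> = T \<or> Re w = \<sigma>" "\<bar>Re w\<bar> \<le> \<bar>\<sigma>\<bar>" "Re w * \<sigma> \<ge> 0"
proof -
  have "w \<in> closed_segment (Complex 0 T) (Complex \<sigma> T) \<or>
     w \<in> closed_segment (Complex \<sigma> T) (Complex \<sigma> (- T)) \<or>
     w \<in> closed_segment (Complex \<sigma> (- T)) (Complex 0 (- T))"
    using assms(1) by (auto simp: closing_path_def path_image_join)
  then have "(\<exists>u. 0 \<le> u \<and> u \<le> 1 \<and> \<bar>Im w\<bar> = T \<and> Re w = u * \<sigma>) \<or> Re w = \<sigma>"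
  proof (elim disjE)
    assume "w \<in> closed_segment (Complex 0 T) (Complex \<sigma> T)"
    then obtain u where u: "0 \<le> u" "u \<le> 1" "w = (1 - u) *\<^sub>R Complex 0 T + u *\<^sub>R Complex \<sigma> T"
      by (auto simp: closed_segment_def)
    show ?thesis using u(1,2) assms(2) unfolding u(3)
      by (intro disjI1 exI[of _ u]) (simp add: left_diff_distrib)
  next
    assume "w \<in> closed_segment (Complex \<sigma> T) (Complex \<sigma> (- T))"
    then obtain u where "w = (1 - u) *\<^sub>R Complex \<sigma> T + u *\<^sub>R Complex \<sigma> (- T)"
      by (auto simp: closed_segment_def)
    then show ?thesis by (simp add: left_diff_distrib)
  next
    assume "w \<in> closed_segment (Complex \<sigma> (- T)) (Complex 0 (- T))"
    then obtain u where u: "0 \<le> u" "u \<le> 1" "w = (1 - u) *\<^sub>R Complex \<sigma> (- T) + u *\<^sub>R Complex 0 (- T)"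
      by (auto simp: closed_segment_def)
    show ?thesis using u(1,2) assms(2) unfolding u(3)
      by (intro disjI1 exI[of _ "1 - u"]) (simp add: left_diff_distrib)
  qed
  moreover have "\<bar>u * \<sigma>\<bar> \<le> \<bar>\<sigma>\<bar>" "u * \<sigma> * \<sigma> \<ge> 0" if "0 \<le> u" "u \<le> 1" for u
    using that by (auto simp: abs_mult mult_left_le_one_le mult.assoc)
  ultimately show "\<bar>Im w\<bar> = T \<or> Re w = \<sigma>" "\<bar>Re w\<bar> \<le> \<bar>\<sigma>\<bar>" "Re w * \<sigma> \<ge> 0"
    by auto
qed

text \<open>A connection from p to far reals may run arbitrarily high and cross the horizontal sides
  of a closing path. Clamping it to a rectangle keeps it connected and creates no contact with
  \<open>L\<close>: a clamped real part has modulus B, larger than all real parts on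
  \<open>L\<close>; a clamped imaginary part has modulus \<open>T0\<close>, where \<open>L\<close>
  is on the axis, so the unclamped point was already on a tail of \<open>L\<close>. The sign
  \<open>\<delta>\<close> is 1 for the left side and - 1 for the right side.\<close>

lemma connected_complement_clamp:
  fixes \<delta> :: real
  assumes R: "0 < R" "R < T0" "\<And>t. R \<le> \<bar>t\<bar> \<Longrightarrow> L t = Complex 0 t"
      "\<And>t. \<bar>t\<bar> \<le> R \<Longrightarrow> norm (L t) < T0"
    and \<delta>: "\<delta> = 1 \<or> \<delta> = - 1"
    and side: "\<And>N. \<exists>x. \<delta> * x \<le> N \<and> connected_component (- range L) p (of_real x)"
    and p: "\<bar>Re p\<bar> \<le> B" "\<bar>Im p\<bar> \<le> T0" and B: "T0 < B"
  obtains C where "connected C" "C \<inter> range L = {}" "p \<in> C" "of_real (- \<delta> * B) \<in> C"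
    "\<And>s. s \<in> C \<Longrightarrow> \<bar>Re s\<bar> \<le> B \<and> \<bar>Im s\<bar> \<le> T0"
proof -
  obtain x where x: "\<delta> * x \<le> - B" "connected_component (- range L) p (of_real x)"
    using side by blast
  then obtain C0 where C0: "connected C0" "C0 \<subseteq> - range L" "p \<in> C0" "of_real x \<in> C0"
    unfolding connected_component_def by blast
  define cl where "cl = (\<lambda>s. Complex (max (- B) (min B (Re s))) (max (- T0) (min T0 (Im s))))"
  have T0: "0 < T0" using R by linarith
  have "connected (cl ` C0)"
    using C0(1) unfolding cl_def Complex_eq
    by (intro connected_continuous_image continuous_intros)
  moreover have "cl s \<notin> range L" if s: "s \<in> C0" for s
  proof
    assume "cl s \<in> range L"
    then obtain t where t: "cl s = L t" by blast
    have ReL: "\<bar>Re (L t)\<bar> < T0"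
      using R T0 abs_Re_le_cmod[of "L t"] by (cases "\<bar>t\<bar> \<le> R") fastforce+
    show False
    proof (cases "\<bar>Re s\<bar> \<le> B")
      case False
      then have "\<bar>Re (cl s)\<bar> = B" using B T0 by (auto simp: cl_def)
      then show False using ReL B t by simp
    next
      case re: True
      show False
      proof (cases "\<bar>Im s\<bar> \<le> T0")
        case True
        then have "cl s = s" using re by (auto simp: cl_def complex_eq_iff)
        then show False using t C0(2) s by auto
      next
        case False
        then have "\<bar>Im (L t)\<bar> = T0" using T0 by (auto simp: cl_def t[symmetric])
        then have "\<not> \<bar>t\<bar> \<le> R" using R(4)[of t] abs_Im_le_cmod[of "L t"] by auto
        then have "Re (cl s) = 0" using R(3)[of t] t by simp
        then have "Re s = 0" using re by (auto simp: cl_def)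
        then have "s = L (Im s)" using R(2) R(3)[of "Im s"] False by (auto simp: complex_eq_iff)
        then show False using C0(2) s by blast
      qed
    qed
  qed
  moreover have "p \<in> cl ` C0"
    using C0(3) p by (intro image_eqI[of _ _ p]) (auto simp: cl_def complex_eq_iff)
  moreover have "of_real (- \<delta> * B) \<in> cl ` C0"
    using C0(4) x(1) \<delta> T0 B by (intro image_eqI[of _ _ "of_real x"]) (auto simp: cl_def complex_eq_iff)
  moreover have "\<bar>Re s\<bar> \<le> B \<and> \<bar>Im s\<bar> \<le> T0" if "s \<in> cl ` C0" for s
    using that T0 B by (auto simp: cl_def)
  ultimately show thesis by (intro that[of "cl ` C0"]) auto
qed

text \<open>The cut of Ln(\<open>\<delta>\<close> * (w - p)) is the horizontal ray from p pointing
  away from \<open>\<sigma>\<close>, which the closing path avoids. The value does not involve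
  \<open>\<sigma>\<close>, so the vertical side can be moved freely on its side of p.\<close>

lemma closing_path_inverse_integral:
  fixes \<delta> :: real
  assumes "\<delta> = 1 \<or> \<delta> = - 1" "T > 0" "\<bar>Im p\<bar> < T" "\<delta> * Re p < \<delta> * \<sigma>"
  shows "contour_integral (closing_path \<sigma> T) (\<lambda>w. 1 / (w - p))
       = Ln (\<delta> * (Complex 0 (- T) - p)) - Ln (\<delta> * (Complex 0 T - p))"
proof -
  define S where "S = {w. \<delta> * (w - p) \<notin> \<real>\<^sub>\<le>\<^sub>0}"
  have "((\<lambda>w. Ln (\<delta> * (w - p))) has_field_derivative 1 / (w - p)) (at w within S)" if "w \<in> S" for w
  proof -
    have "w \<noteq> p" using that by (auto simp: S_def)
    then show ?thesis
      using that assms(1) by (auto intro!: derivative_eq_intros simp: S_def field_simps)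
  qed
  moreover have "path_image (closing_path \<sigma> T) \<subseteq> S"
    using path_image_closing_path(1)[OF _ assms(2), of _ \<sigma>] assms(1,3,4)
    by (fastforce simp: S_def complex_nonpos_Reals_iff)
  ultimately have "((\<lambda>w. 1 / (w - p)) has_contour_integral
      Ln (\<delta> * (pathfinish (closing_path \<sigma> T) - p)) - Ln (\<delta> * (pathstart (closing_path \<sigma> T) - p))) (closing_path \<sigma> T)"
    by (intro contour_integral_primitive) auto
  then show ?thesis by (intro contour_integral_unique) simp
qed

text \<open>The line Re = \<open>\<sigma>\<close> may cut the connection from p to the far reals, so
  the vertical side is first moved out to \<open>\<delta>\<close> * (B + 1), beyond the clamped set
  C. Then p can be joined within C to - \<open>\<delta>\<close> * B, which lies outside a half-plane
  containing the loop. Moving the side back changes nothing, by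
  \<open>closing_path_inverse_integral\<close>.\<close>

lemma winding_number_closed_up_axis:
  fixes \<delta> :: real
  assumes R: "0 < R" "R < T0" "\<And>t. R \<le> \<bar>t\<bar> \<Longrightarrow> L t = Complex 0 t"
      "\<And>t. \<bar>t\<bar> \<le> R \<Longrightarrow> norm (L t) < T0"
      "\<And>T. R \<le> T \<Longrightarrow> L piecewise_C1_differentiable_on {- T..T}"
    and \<delta>: "\<delta> = 1 \<or> \<delta> = - 1"
    and side: "\<And>N. \<exists>x. \<delta> * x \<le> N \<and> connected_component (- range L) p (of_real x)"
    and p: "\<bar>Im p\<bar> \<le> T0" "\<delta> * Re p < \<delta> * \<sigma>" and T: "T0 < T"
  shows "winding_number (truncated_path L T +++ closing_path \<sigma> T) p = 0"
proof -
  define B where "B = max T0 \<bar>Re p\<bar> + 1"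
  have B: "T0 < B" "\<bar>Re p\<bar> \<le> B" by (auto simp: B_def)
  have pos: "0 < T" "0 < T0" using R T by linarith+
  have [simp]: "L T = Complex 0 T" "L (- T) = Complex 0 (- T)" using R T by auto
  obtain C where C: "connected C" "C \<inter> range L = {}" "p \<in> C" "of_real (- \<delta> * B) \<in> C"
    "\<And>s. s \<in> C \<Longrightarrow> \<bar>Re s\<bar> \<le> B \<and> \<bar>Im s\<bar> \<le> T0"
    using connected_complement_clamp[OF R(1-4) \<delta> side B(2) p(1) B(1)] by blast
  have vp: "valid_path (truncated_path L T)"
    using R T by (intro valid_path_truncated_path) auto
  have pA: "path_image (truncated_path L T) \<subseteq> range L"
    using truncated_path_image[OF pos(1), of L] by auto
  have pnot: "p \<notin> range L" using C(2,3) by blast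
  let ?far = "truncated_path L T +++ closing_path (\<delta> * (B + 1)) T"
  have pf: "path_image ?far = path_image (truncated_path L T) \<union> path_image (closing_path (\<delta> * (B + 1)) T)"
    by (simp add: path_image_join)
  have absd: "\<bar>\<delta> * (B + 1)\<bar> = B + 1" using \<delta> B pos by auto
  have disj: "C \<inter> path_image ?far = {}"
  proof -
    have "s \<notin> path_image (closing_path (\<delta> * (B + 1)) T)" if "s \<in> C" for s
      using path_image_closing_path(1)[OF _ pos(1), of s "\<delta> * (B + 1)"] C(5)[OF that] T absd by auto
    then show ?thesis unfolding pf using C(2) pA by blast
  qed
  have "winding_number ?far p = winding_number ?far (of_real (- \<delta> * B))"
    by (rule winding_number_eq[OF _ _ C(3,4,1) disj]) (use vp in \<open>auto intro!: valid_path_imp_path\<close>)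
  also have "\<dots> = 0"
  proof (rule winding_number_zero_outside)
    show "convex {s. \<delta> * Re s > - B}"
      using \<delta> convex_halfspace_Re_gt[of "- B"] convex_halfspace_Re_lt[of B] by auto
    have ReL: "\<bar>Re (L t)\<bar> < T0" for t
      using R pos abs_Re_le_cmod[of "L t"] by (cases "\<bar>t\<bar> \<le> R") fastforce+
    have "\<bar>\<delta> * Re (L t)\<bar> < B" for t
      using ReL[of t] B(1) \<delta> by (auto simp: abs_mult)
    then have "\<delta> * Re (L t) > - B" for t
      by (simp add: abs_less_iff minus_less_iff)
    moreover have "\<delta> * Re s > - B" if "s \<in> path_image (closing_path (\<delta> * (B + 1)) T)" for s
    proof -
      have "0 \<le> (\<delta> * Re s) * (B + 1)"
        using path_image_closing_path(3)[OF that pos(1)] by (simp add: mult_ac)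
      moreover have "0 < B + 1" using B pos by linarith
      ultimately have "0 \<le> \<delta> * Re s" by (simp add: zero_le_mult_iff)
      then show ?thesis using B pos by linarith
    qed
    ultimately show "path_image ?far \<subseteq> {s. \<delta> * Re s > - B}"
      unfolding pf using pA by blast
  qed (use vp \<delta> in \<open>auto intro!: valid_path_imp_path\<close>)
  finally have far0: "winding_number ?far p = 0" .
  have wn: "winding_number (truncated_path L T +++ closing_path \<tau> T) p
      = 1 / (2 * pi * \<i>) * (contour_integral (truncated_path L T) (\<lambda>w. 1 / (w - p)) +
          (Ln (\<delta> * (Complex 0 (- T) - p)) - Ln (\<delta> * (Complex 0 T - p))))"
    if \<tau>: "\<delta> * Re p < \<delta> * \<tau>" for \<tau>
  proof -
    have nE: "p \<notin> path_image (closing_path \<tau> T)"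
      using path_image_closing_path(1)[OF _ pos(1), of p \<tau>] p T \<tau> by auto
    have nA: "p \<notin> path_image (truncated_path L T)" using pnot pA by blast
    have "winding_number (truncated_path L T +++ closing_path \<tau> T) p
       = 1 / (2 * pi * \<i>) * contour_integral (truncated_path L T +++ closing_path \<tau> T) (\<lambda>w. 1 / (w - p))"
      using vp nE nA by (intro winding_number_valid_path) (auto simp: path_image_join)
    also have "contour_integral (truncated_path L T +++ closing_path \<tau> T) (\<lambda>w. 1 / (w - p))
       = contour_integral (truncated_path L T) (\<lambda>w. 1 / (w - p)) + contour_integral (closing_path \<tau> T) (\<lambda>w. 1 / (w - p))"
      using vp nE nA by (intro contour_integral_join contour_integrable_inversediff) auto
    finally show ?thesis
      using closing_path_inverse_integral[OF \<delta> pos(1) _ \<tau>] p T by simp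
  qed
  have "\<delta> * Re p < \<delta> * (\<delta> * (B + 1))"
    using \<delta> B(2) by auto
  from wn[OF this] far0 wn[OF p(2)] show ?thesis by simp
qed

text \<open>Each singularity lies on the same side of \<open>L\<close> and of the vertical line, so
  the loop formed from the two winds around none of them and the global form of Cauchy's theorem
  applies. The bound M lets T exceed the heights of all singularities.\<close>

lemma line_integral_eq_vertical:
  assumes L: "deformed_imag_axis L"
    and cl: "closed (PL \<union> PR)" and im: "\<And>p. p \<in> PL \<union> PR \<Longrightarrow> \<bar>Im p\<bar> \<le> M"
    and PL: "\<And>p. p \<in> PL \<Longrightarrow> left_of L p \<and> Re p < \<sigma>"
    and PR: "\<And>p. p \<in> PR \<Longrightarrow> right_of L p \<and> \<sigma> < Re p"
    and hol: "X holomorphic_on - (PL \<union> PR)" and dec: "strip_decay X"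
  shows "line_integrable_on X L" "line_integral L X = \<i> * vertical_integral \<sigma> X"
proof -
  obtain R T0 where R: "0 < R" "R < T0" "\<And>t. R \<le> \<bar>t\<bar> \<Longrightarrow> L t = Complex 0 t"
    "\<And>t. \<bar>t\<bar> \<le> R \<Longrightarrow> norm (L t) < T0"
    "\<And>T. R \<le> T \<Longrightarrow> L piecewise_C1_differentiable_on {- T..T}"
    using deformed_imag_axisE[OF L] by blast
  obtain \<kappa> C Y where dec0: "\<kappa> > 0" "C \<ge> 0" "Y > 0"
    "\<And>s. \<bar>Re s\<bar> \<le> 0 \<Longrightarrow> Y \<le> \<bar>Im s\<bar> \<Longrightarrow> norm (X s) \<le> C * exp (- \<kappa> * \<bar>Im s\<bar>)"
    using strip_decayD[OF dec, of 0] by blast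
  \<comment> \<open>Above this height \<open>L\<close> is the axis, there are no singularities and
    the decay estimate holds.\<close>
  define T1 where "T1 = max T0 (max M Y)"
  have T1: "T0 \<le> T1" "M \<le> T1" "Y \<le> T1" "R < T1" "0 < T1" using R by (auto simp: T1_def)
  have R': "\<And>t. \<bar>t\<bar> \<le> R \<Longrightarrow> norm (L t) < T1" using R(4) T1(1) by fastforce
  let ?P = "PL \<union> PR"
  have contX: "continuous_on K X" if "K \<subseteq> - ?P" for K
    using that hol by (meson continuous_on_subset holomorphic_on_imp_continuous_on)
  have rangeL: "L t \<notin> ?P" for t
  proof
    assume "L t \<in> ?P"
    then have "\<exists>x. connected_component (- range L) (L t) x"
      using PL[of "L t"] PR[of "L t"] unfolding left_of_def right_of_def
      by (metis Un_iff eventually_at_bot_linorder eventually_at_top_linorder order_refl)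
    then show False using connected_component_in by blast
  qed
  have side: "\<exists>\<delta>. (\<delta> = 1 \<or> \<delta> = - 1) \<and> \<delta> * Re p < \<delta> * \<sigma> \<and>
      (\<forall>N. \<exists>x. \<delta> * x \<le> N \<and> connected_component (- range L) p (of_real x))" if "p \<in> ?P" for p
    using that
  proof
    assume "p \<in> PL"
    then obtain K where "\<And>x. x \<le> K \<Longrightarrow> connected_component (- range L) p (of_real x)"
      using PL unfolding left_of_def eventually_at_bot_linorder by blast
    then have "\<forall>N. \<exists>x. 1 * x \<le> N \<and> connected_component (- range L) p (of_real x)"
      by (metis min.cobounded1 min.cobounded2 mult_1)
    then show ?thesis using PL[OF \<open>p \<in> PL\<close>] by (intro exI[of _ 1] conjI) simp_all
  next
    assume "p \<in> PR"
    then obtain K where "\<And>x. x \<ge> K \<Longrightarrow> connected_component (- range L) p (of_real x)"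
      using PR unfolding right_of_def eventually_at_top_linorder by blast
    then have "(- 1) * max K (- N) \<le> N \<and> connected_component (- range L) p (of_real (max K (- N)))" for N
      by (simp add: max_def)
    then have "\<forall>N. \<exists>x. (- 1) * x \<le> N \<and> connected_component (- range L) p (of_real x)"
      by blast
    then show ?thesis using PR[OF \<open>p \<in> PR\<close>] by (intro exI[of _ "- 1"] conjI) simp_all
  qed
  have nE: "path_image (closing_path \<sigma> T) \<subseteq> - ?P" if "T1 < T" for T
  proof -
    have "w \<notin> ?P" if "w \<in> path_image (closing_path \<sigma> T)" for w
    proof
      assume P: "w \<in> ?P"
      have "Re w \<noteq> \<sigma>" using P PL[of w] PR[of w] by auto
      moreover have "\<bar>Im w\<bar> < T" using im[OF P] \<open>T1 < T\<close> T1 by linarith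
      ultimately show False
        using path_image_closing_path(1)[OF that] \<open>T1 < T\<close> T1 by auto
    qed
    then show ?thesis by blast
  qed
  let ?f = "\<lambda>t. X (L t) * vector_derivative L (at t)"
  have finite_int: "(?f has_integral - contour_integral (closing_path \<sigma> T) X) {- T..T}" if T: "T1 < T" for T
  proof -
    let ?A = "truncated_path L T"
    have pos: "0 < T" using T T1 by linarith
    have [simp]: "L T = Complex 0 T" "L (- T) = Complex 0 (- T)" using R T T1 by auto
    have vp: "valid_path ?A"
      using R T T1 by (intro valid_path_truncated_path) auto
    have pA: "path_image ?A \<subseteq> - ?P"
      using truncated_path_image[OF pos, of L] rangeL by auto
    have "(X has_contour_integral 0) (?A +++ closing_path \<sigma> T)"
    proof (rule Cauchy_theorem_global[OF _ hol])
      show "open (- ?P)" using cl by (rule open_Compl)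
      show "path_image (?A +++ closing_path \<sigma> T) \<subseteq> - ?P"
        using pA nE[OF T] by (simp add: path_image_join)
      fix p assume "p \<notin> - ?P"
      then have pP: "p \<in> ?P" by simp
      from side[OF this] obtain \<delta> where \<delta>: "\<delta> = 1 \<or> \<delta> = - 1" "\<delta> * Re p < \<delta> * \<sigma>"
        "\<And>N. \<exists>x. \<delta> * x \<le> N \<and> connected_component (- range L) p (of_real x)" by blast
      show "winding_number (?A +++ closing_path \<sigma> T) p = 0"
        using im[OF pP] T1 by (intro winding_number_closed_up_axis[OF R(1) T1(4) R(3) R' R(5) \<delta>(1,3) _ \<delta>(2) T]) auto
    qed (use vp in \<open>auto simp: valid_path_join\<close>)
    then have sum0: "contour_integral (?A +++ closing_path \<sigma> T) X = 0"
      by (rule contour_integral_unique)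
    have op: "open (- ?P)" using cl by (rule open_Compl)
    \<comment> \<open>Integrability rests on local primitives of the holomorphic X, not on a bound
      for the derivative of \<open>L\<close>.\<close>
    have cA: "X contour_integrable_on ?A" "X contour_integrable_on closing_path \<sigma> T"
      using contour_integrable_holomorphic_simple[OF hol op] vp pA nE[OF T] by auto
    then have "contour_integral ?A X + contour_integral (closing_path \<sigma> T) X = 0"
      using sum0 vp by simp
    then have "contour_integral ?A X = - contour_integral (closing_path \<sigma> T) X"
      by (simp add: add_eq_0_iff)
    then have "(X has_contour_integral - contour_integral (closing_path \<sigma> T) X) ?A"
      using cA(1) has_contour_integral_integral by fastforce
    then show ?thesis using R T T1 pos by (intro truncated_path_has_integral) auto
  qed
  have tail: "?f t = \<i> * X (Complex 0 t)" if "R < \<bar>t\<bar>" for t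
  proof -
    have "((\<lambda>t. \<i> * complex_of_real t) has_vector_derivative \<i>) (at t)"
      by (auto intro!: derivative_eq_intros)
    then have "(L has_vector_derivative \<i>) (at t)"
    proof (rule has_vector_derivative_transform_within_open)
      show "open {t. R < \<bar>t\<bar>}" by (intro open_Collect_less continuous_intros)
    qed (use that R(3) in \<open>auto simp: complex_eq_iff\<close>)
    then show ?thesis using R(3)[of t] that by (simp add: vector_derivative_at)
  qed
  have axis: "continuous_on S (\<lambda>t. \<i> * X (Complex 0 t))" if "S \<subseteq> {t. T1 < \<bar>t\<bar>}" for S
  proof -
    have "Complex 0 ` S \<subseteq> - ?P" using im T1(2) that by fastforce
    then show ?thesis
      by (intro continuous_intros continuous_on_compose2[OF contX, of "Complex 0 ` S"]) auto
  qed
  let ?T = "T1 + 1"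
  have "?f integrable_on UNIV"
  proof (rule exp_tails_integrable_on[OF _ _ _ dec0(1)])
    show "?f integrable_on {- ?T..?T}" by (rule has_integral_integrable[OF finite_int]) simp
    have "continuous_on S ?f" if "S \<subseteq> {t. T1 < \<bar>t\<bar>}" for S
      using axis[OF that] by (rule continuous_on_cong[THEN iffD1, rotated -1]) (use tail that T1 in fastforce)+
    moreover have "{?T..} \<subseteq> {t. T1 < \<bar>t\<bar>}" "{..- ?T} \<subseteq> {t. T1 < \<bar>t\<bar>}" using T1 by auto
    ultimately show "continuous_on {?T..} ?f" "continuous_on {..- ?T} ?f" by blast+
    show "norm (?f t) \<le> C * exp (- \<kappa> * \<bar>t\<bar>)" if "?T \<le> \<bar>t\<bar>" for t
      using tail[of t] dec0(4)[of "Complex 0 t"] that T1 by (simp add: norm_mult)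
  qed (use T1 in auto)
  then show integrable: "line_integrable_on X L" unfolding line_integrable_on_def .
  have vint: "vertical_integrable \<sigma> X"
    using PL PR by (intro vertical_integrableI dec contX) fastforce
  have vt: "((\<lambda>T. \<i> * integral {- T..T} (\<lambda>t. X (Complex \<sigma> t))) \<longlongrightarrow> \<i> * vertical_integral \<sigma> X) at_top"
    unfolding vertical_integral_def
    using vint unfolding vertical_integrable_def by (intro tendsto_intros symmetric_integral_tendsto)
  have "((\<lambda>T. - (contour_integral (linepath (Complex 0 (1 * T)) (Complex \<sigma> (1 * T))) X
      - \<i> * integral {- T..T} (\<lambda>t. X (Complex \<sigma> t))
      + contour_integral (linepath (Complex \<sigma> (- 1 * T)) (Complex 0 (- 1 * T))) X))
      \<longlongrightarrow> - (0 - \<i> * vertical_integral \<sigma> X + 0)) at_top"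
    by (intro tendsto_intros vt horizontal_integral_tendsto_0 dec) auto
  moreover have "\<forall>\<^sub>F T in at_top. - (contour_integral (linepath (Complex 0 (1 * T)) (Complex \<sigma> (1 * T))) X
      - \<i> * integral {- T..T} (\<lambda>t. X (Complex \<sigma> t))
      + contour_integral (linepath (Complex \<sigma> (- 1 * T)) (Complex 0 (- 1 * T))) X)
      = integral {- T..T} ?f"
    using eventually_gt_at_top[of T1]
  proof eventually_elim
    case (elim T)
    have pos: "0 < T" using elim T1 by linarith
    have PI: "path_image (closing_path \<sigma> T) = closed_segment (Complex 0 T) (Complex \<sigma> T) \<union>
        closed_segment (Complex \<sigma> T) (Complex \<sigma> (- T)) \<union> closed_segment (Complex \<sigma> (- T)) (Complex 0 (- T))"
      by (simp add: closing_path_def path_image_join Un_assoc)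
    have seg: "X contour_integrable_on linepath p q" if "closed_segment p q \<subseteq> path_image (closing_path \<sigma> T)" for p q
      using that nE[OF elim] by (intro contour_integrable_continuous_linepath contX) (rule order_trans)
    have ints: "X contour_integrable_on linepath (Complex 0 T) (Complex \<sigma> T)"
        "X contour_integrable_on linepath (Complex \<sigma> T) (Complex \<sigma> (- T))"
        "X contour_integrable_on linepath (Complex \<sigma> (- T)) (Complex 0 (- T))"
      by (rule seg, unfold PI, blast)+
    have reverse: "contour_integral (linepath (Complex \<sigma> T) (Complex \<sigma> (- T))) X
         = - (\<i> * integral {- T..T} (\<lambda>t. X (Complex \<sigma> t)))"
      using contour_integral_reversepath[of "linepath (Complex \<sigma> (- T)) (Complex \<sigma> T)" X]
        contour_integral_vertical[OF pos, of \<sigma> X] by simp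
    show ?case
      using integral_unique[OF finite_int[OF elim]] ints reverse unfolding closing_path_def
      by (simp add: add_diff_eq)
  qed
  ultimately have lim: "((\<lambda>T. integral {- T..T} ?f) \<longlongrightarrow> - (0 - \<i> * vertical_integral \<sigma> X + 0)) at_top"
    by (rule Lim_transform_eventually)
  have "((\<lambda>T. integral {- T..T} ?f) \<longlongrightarrow> integral UNIV ?f) at_top"
    using integrable unfolding line_integrable_on_def by (rule symmetric_integral_tendsto)
  from tendsto_unique[OF _ this lim] show "line_integral L X = \<i> * vertical_integral \<sigma> X"
    by (simp add: line_integral_def)
qed


section \<open>Barnes' first lemma on a vertical line\<close>

definition barnes_kernel :: "complex \<Rightarrow> complex \<Rightarrow> complex \<Rightarrow> complex \<Rightarrow> complex \<Rightarrow> complex" where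
  "barnes_kernel a b d e s = Gamma (a + s) * Gamma (b + s) * Gamma (d - s) * Gamma (e - s)"

text \<open>The right-hand side of Barnes' first lemma. The entire function \<open>rGamma\<close>
  replaces a division, so the functional equation in the sum of the parameters holds without
  exception.\<close>

definition barnes_value :: "complex \<Rightarrow> complex \<Rightarrow> complex \<Rightarrow> complex \<Rightarrow> complex" where
  "barnes_value a b d e =
     Gamma (a + d) * Gamma (a + e) * Gamma (b + d) * Gamma (b + e) * rGamma (a + b + d + e)"

lemma Re_pos_not_nonpos_Int: "0 < Re z \<Longrightarrow> z \<notin> \<int>\<^sub>\<le>\<^sub>0"
  by (auto elim!: nonpos_Ints_cases)

lemma barnes_kernel_bound:
  "\<exists>C\<ge>0. \<exists>Y. \<forall>s. \<bar>Re s\<bar> \<le> A \<longrightarrow> Y \<le> \<bar>Im s\<bar> \<longrightarrow>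
     norm (barnes_kernel a b d e s) \<le> C * exp (- 4 * \<bar>Im s\<bar>)"
proof -
  have bd: "\<exists>C\<ge>0. \<exists>Y. \<forall>s. \<bar>Re s\<bar> \<le> A \<longrightarrow> Y \<le> \<bar>Im s\<bar> \<longrightarrow>
     norm (Gamma (u + s)) \<le> C * exp (- \<bar>Im s\<bar>) \<and> norm (Gamma (u - s)) \<le> C * exp (- \<bar>Im s\<bar>)" for u
    by (rule norm_Gamma_strip_shift)
  obtain Ca Ya where a: "Ca \<ge> 0" "\<And>s. \<bar>Re s\<bar> \<le> A \<Longrightarrow> Ya \<le> \<bar>Im s\<bar> \<Longrightarrow> norm (Gamma (a + s)) \<le> Ca * exp (- \<bar>Im s\<bar>)"
    using bd[of a] by blast
  obtain Cb Yb where b: "Cb \<ge> 0" "\<And>s. \<bar>Re s\<bar> \<le> A \<Longrightarrow> Yb \<le> \<bar>Im s\<bar> \<Longrightarrow> norm (Gamma (b + s)) \<le> Cb * exp (- \<bar>Im s\<bar>)"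
    using bd[of b] by blast
  obtain Cd Yd where d: "Cd \<ge> 0" "\<And>s. \<bar>Re s\<bar> \<le> A \<Longrightarrow> Yd \<le> \<bar>Im s\<bar> \<Longrightarrow> norm (Gamma (d - s)) \<le> Cd * exp (- \<bar>Im s\<bar>)"
    using bd[of d] by blast
  obtain Ce Ye where e: "Ce \<ge> 0" "\<And>s. \<bar>Re s\<bar> \<le> A \<Longrightarrow> Ye \<le> \<bar>Im s\<bar> \<Longrightarrow> norm (Gamma (e - s)) \<le> Ce * exp (- \<bar>Im s\<bar>)"
    using bd[of e] by blast
  have "norm (barnes_kernel a b d e s) \<le> (Ca * Cb * Cd * Ce) * exp (- 4 * \<bar>Im s\<bar>)"
    if s: "\<bar>Re s\<bar> \<le> A" "max (max Ya Yb) (max Yd Ye) \<le> \<bar>Im s\<bar>" for s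
  proof -
    have "norm (barnes_kernel a b d e s) \<le> (Ca * exp (- \<bar>Im s\<bar>)) * (Cb * exp (- \<bar>Im s\<bar>)) *
       (Cd * exp (- \<bar>Im s\<bar>)) * (Ce * exp (- \<bar>Im s\<bar>))"
      unfolding barnes_kernel_def norm_mult using s a b d e
      by (intro mult_mono) auto
    also have "\<dots> = (Ca * Cb * Cd * Ce) * (exp (- \<bar>Im s\<bar>)) ^ 4"
      by (simp add: power4_eq_xxxx mult_ac)
    also have "(exp (- \<bar>Im s\<bar>)) ^ 4 = exp (- 4 * \<bar>Im s\<bar>)"
      by (simp flip: exp_of_nat_mult)
    finally show ?thesis .
  qed
  moreover have "Ca * Cb * Cd * Ce \<ge> 0" using a b d e by simp
  ultimately show ?thesis by blast
qed

text \<open>The kernel has rate 4, one for each Gamma factor. The 15/4 granted to m is 13/4 > pi for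
  z^s plus 1/2 for the majorant of the binomial series, which leaves the rate 1/4.\<close>

lemma strip_decay_kernel_mult:
  assumes "\<And>A. \<exists>C Y. \<forall>s. \<bar>Re s\<bar> \<le> A \<longrightarrow> Y \<le> \<bar>Im s\<bar> \<longrightarrow> norm (m s) \<le> C * exp (15/4 * \<bar>Im s\<bar>)"
  shows "strip_decay (\<lambda>s. barnes_kernel a b d e s * m s)"
  unfolding strip_decay_def
proof
  fix A
  obtain C Y where C: "C \<ge> 0" "\<And>s. \<bar>Re s\<bar> \<le> A \<Longrightarrow> Y \<le> \<bar>Im s\<bar> \<Longrightarrow>
     norm (barnes_kernel a b d e s) \<le> C * exp (- 4 * \<bar>Im s\<bar>)"
    using barnes_kernel_bound[of A a b d e] by blast
  obtain C' Y' where C': "\<And>s. \<bar>Re s\<bar> \<le> A \<Longrightarrow> Y' \<le> \<bar>Im s\<bar> \<Longrightarrow> norm (m s) \<le> C' * exp (15/4 * \<bar>Im s\<bar>)"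
    using assms[of A] by blast
  have "norm (barnes_kernel a b d e s * m s) \<le> (C * C') * exp (- (1/4) * \<bar>Im s\<bar>)"
    if "\<bar>Re s\<bar> \<le> A" "max Y Y' \<le> \<bar>Im s\<bar>" for s
  proof -
    have "norm (barnes_kernel a b d e s * m s) \<le> (C * exp (- 4 * \<bar>Im s\<bar>)) * (C' * exp (15/4 * \<bar>Im s\<bar>))"
      unfolding norm_mult using that C C' by (intro mult_mono) auto
    also have "\<dots> = (C * C') * (exp (- 4 * \<bar>Im s\<bar>) * exp (15/4 * \<bar>Im s\<bar>))"
      by (simp add: mult_ac)
    also have "exp (- 4 * \<bar>Im s\<bar>) * exp (15/4 * \<bar>Im s\<bar>) = exp (- (1/4) * \<bar>Im s\<bar>)"
      by (simp flip: exp_add)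
    finally show ?thesis .
  qed
  then show "\<exists>\<kappa>>0. \<exists>C Y. \<forall>s. \<bar>Re s\<bar> \<le> A \<longrightarrow> Y \<le> \<bar>Im s\<bar> \<longrightarrow>
      norm (barnes_kernel a b d e s * m s) \<le> C * exp (- \<kappa> * \<bar>Im s\<bar>)"
    by (intro exI[of _ "1/4"] conjI exI[of _ "C * C'"] exI[of _ "max Y Y'"]) auto
qed

lemma strip_decay_kernel: "strip_decay (barnes_kernel a b d e)"
proof -
  have "strip_decay (\<lambda>s. barnes_kernel a b d e s * 1)"
    by (intro strip_decay_kernel_mult exI[of _ 1] exI[of _ 0]) auto
  then show ?thesis by simp
qed

lemma holomorphic_barnes_kernel:
  assumes "\<And>s. s \<in> S \<Longrightarrow> a + s \<notin> \<int>\<^sub>\<le>\<^sub>0 \<and> b + s \<notin> \<int>\<^sub>\<le>\<^sub>0 \<and> d - s \<notin> \<int>\<^sub>\<le>\<^sub>0 \<and> e - s \<notin> \<int>\<^sub>\<le>\<^sub>0"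
  shows "barnes_kernel a b d e holomorphic_on S"
  unfolding barnes_kernel_def[abs_def] using assms by (intro holomorphic_intros) auto

lemma holomorphic_barnes_kernel_strip:
  "barnes_kernel a b d e holomorphic_on
     {s. - min (Re a) (Re b) < Re s \<and> Re s < min (Re d) (Re e)}"
  by (intro holomorphic_barnes_kernel conjI Re_pos_not_nonpos_Int) auto

lemma vertical_integrable_barnes_kernel:
  assumes "0 < Re a" "0 < Re b" "0 < Re d" "0 < Re e"
  shows "vertical_integrable 0 (barnes_kernel a b d e)"
  using holomorphic_on_imp_continuous_on[OF holomorphic_barnes_kernel_strip[of a b d e]] assms
  by (intro vertical_integrableI strip_decay_kernel) (auto elim!: continuous_on_subset)

lemma vertical_integral_barnes_kernel_shift:
  "vertical_integral \<sigma> (barnes_kernel a b d e)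
     = vertical_integral 0 (barnes_kernel (a + of_real \<sigma>) (b + of_real \<sigma>) (d - of_real \<sigma>) (e - of_real \<sigma>))"
proof -
  have "Complex \<sigma> t = of_real \<sigma> + Complex 0 t" for t
    by (simp add: complex_eq_iff)
  then show ?thesis unfolding vertical_integral_def barnes_kernel_def
    by (simp add: add.assoc diff_diff_eq)
qed

text \<open>The left kernel at s is the right kernel at s + 1, which turns the line into Re = 1. The
  right-hand poles of the latter kernel begin at d + 1 and e + 1, so the line can be moved back to
  0.\<close>

lemma barnes_kernel_reflect_shift:
  assumes "0 < Re a" "0 < Re b" "0 < Re d" "0 < Re e"
  shows "vertical_integral 0 (barnes_kernel (a + 1) (b + 1) d e)
       = vertical_integral 0 (barnes_kernel a b (d + 1) (e + 1))"
proof -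
  have "vertical_integral 0 (barnes_kernel (a + 1) (b + 1) d e)
      = vertical_integral 1 (barnes_kernel a b (d + 1) (e + 1))"
    using vertical_integral_barnes_kernel_shift[of 1 a b "d + 1" "e + 1"] by simp
  also have "\<dots> = vertical_integral 0 (barnes_kernel a b (d + 1) (e + 1))"
    using assms
    by (intro vertical_integral_shift[OF _ _ _ holomorphic_barnes_kernel_strip strip_decay_kernel]) auto
  finally show ?thesis .
qed

text \<open>Divided by the kernel, the pointwise identity reads (a + b + d + e)(d - s) = (a + d)(b +
  d) - (a + s)(b + s) + (d - s)(e - s). The last two terms have integrals that cancel, by
  \<open>barnes_kernel_reflect_shift\<close>.\<close>

lemma barnes_recurrence:
  assumes pos: "0 < Re a" "0 < Re b" "0 < Re d" "0 < Re e"
  shows "(a + b + d + e) * vertical_integral 0 (barnes_kernel a b (d + 1) e)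
       = (a + d) * (b + d) * vertical_integral 0 (barnes_kernel a b d e)"
proof -
  let ?s = "\<lambda>t. Complex 0 t"
  note int = vertical_integrable_barnes_kernel[unfolded vertical_integrable_def]
  have i: "(\<lambda>t. barnes_kernel a b (d + 1) e (?s t)) integrable_on UNIV"
      "(\<lambda>t. barnes_kernel a b d e (?s t)) integrable_on UNIV"
      "(\<lambda>t. barnes_kernel (a + 1) (b + 1) d e (?s t)) integrable_on UNIV"
      "(\<lambda>t. barnes_kernel a b (d + 1) (e + 1) (?s t)) integrable_on UNIV"
    using pos by (auto intro!: int)
  have eq: "(a + b + d + e) * barnes_kernel a b (d + 1) e s =
      (a + d) * (b + d) * barnes_kernel a b d e s - barnes_kernel (a + 1) (b + 1) d e s
        + barnes_kernel a b (d + 1) (e + 1) s" if "Re s = 0" for s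
  proof -
    have G: "Gamma (a + 1 + s) = (a + s) * Gamma (a + s)" "Gamma (b + 1 + s) = (b + s) * Gamma (b + s)"
        "Gamma (d + 1 - s) = (d - s) * Gamma (d - s)" "Gamma (e + 1 - s) = (e - s) * Gamma (e - s)"
      using Gamma_plus1[of "a + s"] Gamma_plus1[of "b + s"] Gamma_plus1[of "d - s"] Gamma_plus1[of "e - s"]
        pos that by (simp_all add: Re_pos_not_nonpos_Int algebra_simps)
    show ?thesis unfolding barnes_kernel_def G by (simp add: algebra_simps)
  qed
  have "(a + b + d + e) * vertical_integral 0 (barnes_kernel a b (d + 1) e)
      = integral UNIV (\<lambda>t. (a + b + d + e) * barnes_kernel a b (d + 1) e (?s t))"
    unfolding vertical_integral_def by simp
  also have "\<dots> = integral UNIV (\<lambda>t. (a + d) * (b + d) * barnes_kernel a b d e (?s t)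
      - barnes_kernel (a + 1) (b + 1) d e (?s t) + barnes_kernel a b (d + 1) (e + 1) (?s t))"
    by (subst eq) auto
  also have "\<dots> = (a + d) * (b + d) * vertical_integral 0 (barnes_kernel a b d e)
      - vertical_integral 0 (barnes_kernel (a + 1) (b + 1) d e)
      + vertical_integral 0 (barnes_kernel a b (d + 1) (e + 1))"
    unfolding vertical_integral_def
    using i by (simp add: Henstock_Kurzweil_Integration.integral_add
        Henstock_Kurzweil_Integration.integral_diff integrable_diff integrable_on_mult_right)
  finally show ?thesis using barnes_kernel_reflect_shift[OF pos] by simp
qed

lemma barnes_recurrence_pochhammer:
  assumes pos: "0 < Re a" "0 < Re b" "0 < Re d" "0 < Re e"
  shows "pochhammer (a + b + d + e) n * vertical_integral 0 (barnes_kernel a b (d + of_nat n) e)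
       = pochhammer (a + d) n * pochhammer (b + d) n * vertical_integral 0 (barnes_kernel a b d e)"
proof (induction n)
  case (Suc n)
  have "(a + b + (d + of_nat n) + e) * vertical_integral 0 (barnes_kernel a b (d + of_nat n + 1) e)
       = (a + (d + of_nat n)) * (b + (d + of_nat n)) * vertical_integral 0 (barnes_kernel a b (d + of_nat n) e)"
    using pos by (intro barnes_recurrence) auto
  moreover have "d + of_nat (Suc n) = d + of_nat n + 1" by simp
  ultimately show ?case
    using Suc.IH unfolding pochhammer_Suc by (simp only:) algebra
qed simp

text \<open>In Gauss's products the powers n^x n^y and n^u n^w cancel because x + y = u + w.\<close>

lemma pochhammer_quotient_tendsto:
  fixes x y u w :: complex
  assumes "x + y = u + w" "x \<notin> \<int>\<^sub>\<le>\<^sub>0" "y \<notin> \<int>\<^sub>\<le>\<^sub>0"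
  shows "(\<lambda>n. pochhammer x n * pochhammer y n / (pochhammer u n * pochhammer w n))
           \<longlonglongrightarrow> Gamma u * Gamma w / (Gamma x * Gamma y)"
proof (rule Lim_transform_eventually)
  show "(\<lambda>n. Gamma_series' u n * Gamma_series' w n / (Gamma_series' x n * Gamma_series' y n))
           \<longlonglongrightarrow> Gamma u * Gamma w / (Gamma x * Gamma y)"
    using assms by (intro tendsto_intros Gamma_series'_LIMSEQ) (auto simp: Gamma_eq_zero_iff)
  have "Gamma_series' u n * Gamma_series' w n / (Gamma_series' x n * Gamma_series' y n) =
      pochhammer x n * pochhammer y n / (pochhammer u n * pochhammer w n)" for n
  proof -
    let ?l = "complex_of_real (ln (real n))"
    have "exp (u * ?l) * exp (w * ?l) = exp (x * ?l) * exp (y * ?l)"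
      using assms(1) by (simp flip: exp_add distrib_right)
    then have "Gamma_series' u n * Gamma_series' w n =
        (fact (n - 1))\<^sup>2 * (exp (x * ?l) * exp (y * ?l)) / (pochhammer u n * pochhammer w n)"
      by (simp add: Gamma_series'_def power2_eq_square)
    moreover have "Gamma_series' x n * Gamma_series' y n =
        (fact (n - 1))\<^sup>2 * (exp (x * ?l) * exp (y * ?l)) / (pochhammer x n * pochhammer y n)"
      by (simp add: Gamma_series'_def power2_eq_square)
    ultimately show ?thesis by simp
  qed
  then show "\<forall>\<^sub>F n in sequentially. Gamma_series' u n * Gamma_series' w n / (Gamma_series' x n * Gamma_series' y n) =
      pochhammer x n * pochhammer y n / (pochhammer u n * pochhammer w n)" by simp
qed

text \<open>The quotient is of order n^(r - Re w).\<close>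

lemma Gamma_norm_quotient_tendsto_0:
  fixes w :: complex and r :: real
  assumes "0 < r" "r < Re w"
  shows "(\<lambda>n. Gamma (r + real n) / norm (Gamma (w + of_nat n))) \<longlonglongrightarrow> 0"
proof -
  have nz: "Gamma r \<noteq> 0" using Gamma_real_pos[OF assms(1)] by simp
  have w: "w \<notin> \<int>\<^sub>\<le>\<^sub>0" using assms by (intro Re_pos_not_nonpos_Int) auto
  have r: "r \<notin> \<int>\<^sub>\<le>\<^sub>0" using assms(1) by (auto elim!: nonpos_Ints_cases)
  have "(\<lambda>n. real n powr (r - Re w)) \<longlonglongrightarrow> 0"
    using assms by (intro tendsto_neg_powr filterlim_real_sequentially) auto
  then have "(\<lambda>n. norm (Gamma_series' w n) / Gamma_series' r n * (Gamma r / norm (Gamma w)) * real n powr (r - Re w))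
      \<longlonglongrightarrow> norm (Gamma w) / Gamma r * (Gamma r / norm (Gamma w)) * 0"
    using nz by (intro tendsto_intros Gamma_series'_LIMSEQ)
  moreover have "\<forall>\<^sub>F n in sequentially.
      norm (Gamma_series' w n) / Gamma_series' r n * (Gamma r / norm (Gamma w)) * real n powr (r - Re w)
        = Gamma (r + real n) / norm (Gamma (w + of_nat n))"
    using eventually_gt_at_top[of 0]
  proof eventually_elim
    case (elim n)
    have "Gamma (r + real n) = pochhammer r n * Gamma r"
      using pochhammer_Gamma[OF r, of n] nz by simp
    moreover have "Gamma (w + of_nat n) = pochhammer w n * Gamma w"
      using pochhammer_Gamma[OF w, of n] w by (simp add: Gamma_eq_zero_iff)
    moreover have "real n powr (r - Re w) = exp (r * ln (real n)) / exp (Re w * ln (real n))"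
      using elim by (simp add: powr_def left_diff_distrib exp_diff)
    ultimately show ?case
      by (simp add: Gamma_series'_def norm_mult norm_divide)
  qed
  ultimately show ?thesis by (auto intro: Lim_transform_eventually)
qed

text \<open>On the line only Gamma(d - s) depends on d, and its modulus is at most Gamma(Re d -
  \<open>\<sigma>\<close>); K is the integral of the modulus of the other three factors. The line
  runs between the poles e and e + 1.\<close>

lemma barnes_remainder_bound:
  fixes a b e :: complex
  assumes "0 < Re a" "0 < Re b" "0 < Re e" "Re e < \<sigma>" "\<sigma> < Re e + 1"
  shows "\<exists>K. \<forall>d. \<sigma> < Re d \<longrightarrow> norm (vertical_integral \<sigma> (barnes_kernel a b d e)) \<le> K * Gamma (Re d - \<sigma>)"
proof -
  define h where "h = (\<lambda>s. Gamma (a + s) * Gamma (b + s) * Gamma (e - s))"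
  have noint: "e - s \<notin> \<int>\<^sub>\<le>\<^sub>0" if "Re s = \<sigma>" for s
  proof
    assume "e - s \<in> \<int>\<^sub>\<le>\<^sub>0"
    then obtain k where "e - s = - of_nat k" by (auto elim!: nonpos_Ints_cases')
    then have "Re e - \<sigma> = - real k" using that by (metis minus_complex.sel(1) uminus_complex.sel(1) complex_Re_of_nat)
    then show False using assms(4,5) by (cases k) auto
  qed
  have ab: "a + s \<notin> \<int>\<^sub>\<le>\<^sub>0" "b + s \<notin> \<int>\<^sub>\<le>\<^sub>0" if "Re s = \<sigma>" for s
    using that assms by (auto intro!: Re_pos_not_nonpos_Int)
  have conth: "continuous_on {s. Re s = \<sigma>} h"
    unfolding h_def using noint ab
    by (intro holomorphic_on_imp_continuous_on holomorphic_intros) auto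
  have "strip_decay h"
    unfolding strip_decay_def
  proof
    fix A
    have bd: "\<exists>C\<ge>0. \<exists>Y. \<forall>s. \<bar>Re s\<bar> \<le> A \<longrightarrow> Y \<le> \<bar>Im s\<bar> \<longrightarrow>
       norm (Gamma (u + s)) \<le> C * exp (- \<bar>Im s\<bar>) \<and> norm (Gamma (u - s)) \<le> C * exp (- \<bar>Im s\<bar>)" for u
      by (rule norm_Gamma_strip_shift)
    obtain Ca Ya where a: "Ca \<ge> 0" "\<And>s. \<bar>Re s\<bar> \<le> A \<Longrightarrow> Ya \<le> \<bar>Im s\<bar> \<Longrightarrow> norm (Gamma (a + s)) \<le> Ca * exp (- \<bar>Im s\<bar>)"
      using bd[of a] by blast
    obtain Cb Yb where b: "Cb \<ge> 0" "\<And>s. \<bar>Re s\<bar> \<le> A \<Longrightarrow> Yb \<le> \<bar>Im s\<bar> \<Longrightarrow> norm (Gamma (b + s)) \<le> Cb * exp (- \<bar>Im s\<bar>)"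
      using bd[of b] by blast
    obtain Ce Ye where e: "Ce \<ge> 0" "\<And>s. \<bar>Re s\<bar> \<le> A \<Longrightarrow> Ye \<le> \<bar>Im s\<bar> \<Longrightarrow> norm (Gamma (e - s)) \<le> Ce * exp (- \<bar>Im s\<bar>)"
      using bd[of e] by blast
    have "norm (h s) \<le> (Ca * Cb * Ce) * exp (- 3 * \<bar>Im s\<bar>)"
      if s: "\<bar>Re s\<bar> \<le> A" "max (max Ya Yb) Ye \<le> \<bar>Im s\<bar>" for s
    proof -
      have "norm (h s) \<le> (Ca * exp (- \<bar>Im s\<bar>)) * (Cb * exp (- \<bar>Im s\<bar>)) * (Ce * exp (- \<bar>Im s\<bar>))"
        unfolding h_def norm_mult using s a b e by (intro mult_mono) auto
      also have "\<dots> = (Ca * Cb * Ce) * (exp (- \<bar>Im s\<bar>)) ^ 3"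
        by (simp add: power3_eq_cube mult_ac)
      also have "(exp (- \<bar>Im s\<bar>)) ^ 3 = exp (- 3 * \<bar>Im s\<bar>)"
        by (simp flip: exp_of_nat_mult)
      finally show ?thesis .
    qed
    then show "\<exists>\<kappa>>0. \<exists>C Y. \<forall>s. \<bar>Re s\<bar> \<le> A \<longrightarrow> Y \<le> \<bar>Im s\<bar> \<longrightarrow> norm (h s) \<le> C * exp (- \<kappa> * \<bar>Im s\<bar>)"
      by (intro exI[of _ 3] conjI exI[of _ "Ca * Cb * Ce"] exI[of _ "max (max Ya Yb) Ye"]) auto
  qed
  \<comment> \<open>The real function norm (h s) is made complex-valued to reuse
    \<open>vertical_integrableI\<close>; its real part is taken afterwards.\<close>
  then have "strip_decay (\<lambda>s. complex_of_real (norm (h s)))"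
    unfolding strip_decay_def by simp
  then have "vertical_integrable \<sigma> (\<lambda>s. complex_of_real (norm (h s)))"
    using conth by (intro vertical_integrableI continuous_intros)
  then have nh: "(\<lambda>t. norm (h (Complex \<sigma> t))) integrable_on UNIV"
    unfolding vertical_integrable_def using integrable_component[of _ UNIV 1] by fastforce
  have "norm (vertical_integral \<sigma> (barnes_kernel a b d e)) \<le> integral UNIV (\<lambda>t. norm (h (Complex \<sigma> t))) * Gamma (Re d - \<sigma>)"
    if d: "\<sigma> < Re d" for d
  proof -
    have "norm (barnes_kernel a b d e (Complex \<sigma> t)) \<le> norm (h (Complex \<sigma> t)) * Gamma (Re d - \<sigma>)" for t
    proof -
      have "norm (Gamma (d - Complex \<sigma> t)) \<le> Gamma (Re d - \<sigma>)"
        using norm_Gamma_le_Gamma_Re[of "d - Complex \<sigma> t"] d by simp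
      then have "norm (h (Complex \<sigma> t)) * norm (Gamma (d - Complex \<sigma> t)) \<le> norm (h (Complex \<sigma> t)) * Gamma (Re d - \<sigma>)"
        by (intro mult_left_mono) auto
      then show ?thesis by (simp add: h_def barnes_kernel_def norm_mult mult_ac)
    qed
    moreover have "(\<lambda>t. barnes_kernel a b d e (Complex \<sigma> t)) integrable_on UNIV"
    proof -
      have "barnes_kernel a b d e holomorphic_on {s. Re s = \<sigma>}"
        using noint ab d by (intro holomorphic_barnes_kernel) (auto intro!: Re_pos_not_nonpos_Int)
      then have "vertical_integrable \<sigma> (barnes_kernel a b d e)"
        by (intro vertical_integrableI strip_decay_kernel holomorphic_on_imp_continuous_on)
      then show ?thesis unfolding vertical_integrable_def .
    qed
    ultimately show ?thesis
      unfolding vertical_integral_def using nh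
      by (subst integral_mult_left[symmetric]) (intro integral_norm_bound_integral integrable_on_mult_left; simp)
  qed
  then show ?thesis by blast
qed

text \<open>Only the pole at \<open>s = e\<close> is crossed, and it dominates as the real part of \<open>d\<close> grows.\<close>

lemma barnes_asymptotic:
  fixes a b d e :: complex
  assumes pos: "0 < Re a" "0 < Re b" "0 < Re e" and d: "Re e + 1 < Re d"
  shows "(\<lambda>n. vertical_integral 0 (barnes_kernel a b (d + of_nat n) e) / Gamma (d - e + of_nat n))
           \<longlonglongrightarrow> 2 * pi * (Gamma (a + e) * Gamma (b + e))"
proof -
  \<comment> \<open>Half way between the poles e and e + 1; relative to Gamma(d - e + n) the
    remainder on this line is at most of order n^(-1/2).\<close>
  define \<sigma> where "\<sigma> = Re e + 1/2"
  obtain K where K: "\<And>d. \<sigma> < Re d \<Longrightarrow> norm (vertical_integral \<sigma> (barnes_kernel a b d e)) \<le> K * Gamma (Re d - \<sigma>)"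
    using barnes_remainder_bound[OF pos, of \<sigma>] by (auto simp: \<sigma>_def)
  have residue: "vertical_integral 0 (barnes_kernel a b d' e)
      = vertical_integral \<sigma> (barnes_kernel a b d' e) + 2 * pi * (Gamma (a + e) * Gamma (b + e)) * Gamma (d' - e)"
    if d': "Re e + 1 < Re d'" for d'
  proof -
    \<comment> \<open>By the functional equation (s - e) Gamma(e - s) = - Gamma(e + 1 - s), so
      \<open>g\<close> is the kernel with its pole at e removed.\<close>
    define g where "g = (\<lambda>s. - (Gamma (a + s) * Gamma (b + s) * Gamma (d' - s) * Gamma (e + 1 - s)))"
    let ?l = "- min (Re a) (Re b)" and ?u = "Re e + 1"
    have "vertical_integral \<sigma> (barnes_kernel a b d' e) - vertical_integral 0 (barnes_kernel a b d' e) = 2 * pi * g e"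
    proof (rule vertical_integral_residue[where l = ?l and u = ?u and g = g and e = e])
      show "g holomorphic_on {s. ?l < Re s \<and> Re s < ?u}"
        unfolding g_def using d' by (intro holomorphic_intros Re_pos_not_nonpos_Int) auto
      show "barnes_kernel a b d' e s = g s / (s - e)" if "?l < Re s" "Re s < ?u" "s \<noteq> e" for s
      proof -
        have "e - s \<notin> \<int>\<^sub>\<le>\<^sub>0"
        proof
          assume "e - s \<in> \<int>\<^sub>\<le>\<^sub>0"
          then obtain k where k: "e - s = - of_nat k" by (auto elim!: nonpos_Ints_cases')
          then have "Re e - Re s = - real k" by (metis minus_complex.sel(1) uminus_complex.sel(1) complex_Re_of_nat)
          then have "k = 0" using that(2) by (cases k) auto
          then show False using k that(3) by simp
        qed
        then have shift: "Gamma (e + 1 - s) = (e - s) * Gamma (e - s)"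
          using Gamma_plus1[of "e - s"] by (simp add: algebra_simps)
        show ?thesis using that(3) unfolding g_def barnes_kernel_def shift
          by (simp add: divide_simps) (simp add: algebra_simps)
      qed
    qed (use pos in \<open>auto simp: \<sigma>_def strip_decay_kernel\<close>)
    then show ?thesis by (simp add: g_def algebra_simps)
  qed
  let ?w = "\<lambda>n. Gamma (d - e + of_nat n)"
  have wnz: "?w n \<noteq> 0" for n
    using d by (auto simp: Gamma_eq_zero_iff intro!: Re_pos_not_nonpos_Int dest: Re_pos_not_nonpos_Int[rotated])
  have "(\<lambda>n. vertical_integral \<sigma> (barnes_kernel a b (d + of_nat n) e) / ?w n) \<longlonglongrightarrow> 0"
  proof (rule Lim_null_comparison)
    have "norm (vertical_integral \<sigma> (barnes_kernel a b (d + of_nat n) e) / ?w n)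
        \<le> K * (Gamma (Re d - \<sigma> + real n) / norm (?w n))" for n
      using K[of "d + of_nat n"] d wnz[of n]
      by (simp add: norm_divide \<sigma>_def divide_right_mono algebra_simps)
    then show "\<forall>\<^sub>F n in sequentially. norm (vertical_integral \<sigma> (barnes_kernel a b (d + of_nat n) e) / ?w n)
        \<le> K * (Gamma (Re d - \<sigma> + real n) / norm (?w n))" by simp
    have "(\<lambda>n. Gamma (Re d - \<sigma> + real n) / norm (?w n)) \<longlonglongrightarrow> 0"
      using d by (intro Gamma_norm_quotient_tendsto_0) (auto simp: \<sigma>_def)
    then show "(\<lambda>n. K * (Gamma (Re d - \<sigma> + real n) / norm (?w n))) \<longlonglongrightarrow> 0"
      by (rule tendsto_mult_right_zero)
  qed
  then have "(\<lambda>n. vertical_integral \<sigma> (barnes_kernel a b (d + of_nat n) e) / ?w n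
      + 2 * pi * (Gamma (a + e) * Gamma (b + e))) \<longlonglongrightarrow> 0 + 2 * pi * (Gamma (a + e) * Gamma (b + e))"
    by (intro tendsto_intros)
  moreover have "vertical_integral \<sigma> (barnes_kernel a b (d + of_nat n) e) / ?w n
      + 2 * pi * (Gamma (a + e) * Gamma (b + e))
      = vertical_integral 0 (barnes_kernel a b (d + of_nat n) e) / ?w n" for n
    using residue[of "d + of_nat n"] d wnz[of n] by (simp add: field_simps)
  ultimately show ?thesis by simp
qed

text \<open>The integral for d + n, divided by Gamma(d - e + n), has its limit computed twice: by
  \<open>barnes_asymptotic\<close>, and from the recurrence as a multiple of J times a Pochhammer
  quotient, which converges because (a + d) + (b + d) = (a + b + d + e) + (d - e). Comparing the two
  determines J.\<close>

lemma barnes_first_lemma_large: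
  fixes a b d e :: complex
  assumes pos: "0 < Re a" "0 < Re b" "0 < Re e" and d: "Re e + 1 < Re d"
  shows "vertical_integral 0 (barnes_kernel a b d e) = 2 * pi * barnes_value a b d e"
proof -
  define J where "J = vertical_integral 0 (barnes_kernel a b d e)"
  let ?S = "a + b + d + e"
  have posd: "0 < Re d" using pos d by linarith
  have np: "?S \<notin> \<int>\<^sub>\<le>\<^sub>0" "a + d \<notin> \<int>\<^sub>\<le>\<^sub>0" "b + d \<notin> \<int>\<^sub>\<le>\<^sub>0" "d - e \<notin> \<int>\<^sub>\<le>\<^sub>0"
    using pos posd d by (auto intro!: Re_pos_not_nonpos_Int)
  have eq: "vertical_integral 0 (barnes_kernel a b (d + of_nat n) e) / Gamma (d - e + of_nat n)
     = J / Gamma (d - e) * (pochhammer (a + d) n * pochhammer (b + d) n / (pochhammer ?S n * pochhammer (d - e) n))" for n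
  proof -
    have "pochhammer ?S n \<noteq> 0" "pochhammer (d - e) n \<noteq> 0"
      using np pochhammer_eq_0_imp_nonpos_Int by blast+
    moreover have "Gamma (d - e + of_nat n) = pochhammer (d - e) n * Gamma (d - e)"
      using pochhammer_Gamma[OF np(4), of n] np(4) by (simp add: Gamma_eq_zero_iff)
    moreover have "Gamma (d - e) \<noteq> 0" using np(4) by (simp add: Gamma_eq_zero_iff)
    ultimately show ?thesis
      using barnes_recurrence_pochhammer[OF pos(1,2) posd pos(3), of n] unfolding J_def
      by (simp add: field_simps)
  qed
  have "(\<lambda>n. J / Gamma (d - e) * (pochhammer (a + d) n * pochhammer (b + d) n / (pochhammer ?S n * pochhammer (d - e) n)))
     \<longlonglongrightarrow> J / Gamma (d - e) * (Gamma ?S * Gamma (d - e) / (Gamma (a + d) * Gamma (b + d)))"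
    using np by (intro tendsto_intros pochhammer_quotient_tendsto) auto
  then have "J / Gamma (d - e) * (Gamma ?S * Gamma (d - e) / (Gamma (a + d) * Gamma (b + d)))
      = 2 * pi * (Gamma (a + e) * Gamma (b + e))"
    using barnes_asymptotic[OF pos d] unfolding eq by (rule LIMSEQ_unique)
  then show ?thesis
    using np unfolding J_def[symmetric] barnes_value_def
    by (simp add: Gamma_eq_zero_iff rGamma_inverse_Gamma field_simps)
qed

text \<open>The recurrence leads back to d from d + n, where n is so large that the pole at e is
  isolated from those at d + n and beyond.\<close>

lemma barnes_first_lemma:
  fixes a b d e :: complex
  assumes pos: "0 < Re a" "0 < Re b" "0 < Re d" "0 < Re e"
  shows "vertical_integral 0 (barnes_kernel a b d e) = 2 * pi * barnes_value a b d e"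
proof -
  obtain n :: nat where n: "real n > Re e + 1 - Re d" using reals_Archimedean2 by blast
  let ?S = "a + b + d + e"
  have np: "?S \<notin> \<int>\<^sub>\<le>\<^sub>0" "a + d \<notin> \<int>\<^sub>\<le>\<^sub>0" "b + d \<notin> \<int>\<^sub>\<le>\<^sub>0"
    using pos by (auto intro!: Re_pos_not_nonpos_Int)
  have nz: "pochhammer (a + d) n \<noteq> 0" "pochhammer (b + d) n \<noteq> 0" "pochhammer ?S n \<noteq> 0"
    using np pochhammer_eq_0_imp_nonpos_Int by blast+
  have large: "vertical_integral 0 (barnes_kernel a b (d + of_nat n) e) = 2 * pi * barnes_value a b (d + of_nat n) e"
    using pos n by (intro barnes_first_lemma_large) auto
  have "barnes_value a b (d + of_nat n) e * pochhammer ?S n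
      = barnes_value a b d e * (pochhammer (a + d) n * pochhammer (b + d) n)"
  proof -
    have "Gamma (a + (d + of_nat n)) = pochhammer (a + d) n * Gamma (a + d)"
         "Gamma (b + (d + of_nat n)) = pochhammer (b + d) n * Gamma (b + d)"
      using pochhammer_Gamma[OF np(2), of n] pochhammer_Gamma[OF np(3), of n] np
      by (simp_all add: Gamma_eq_zero_iff add.assoc)
    moreover have "rGamma ?S = pochhammer ?S n * rGamma (a + b + (d + of_nat n) + e)"
      using pochhammer_rGamma[of ?S n] by (simp add: add_ac)
    ultimately show ?thesis unfolding barnes_value_def by (simp only: mult_ac)
  qed
  then have "(pochhammer (a + d) n * pochhammer (b + d) n) * vertical_integral 0 (barnes_kernel a b d e)
      = (pochhammer (a + d) n * pochhammer (b + d) n) * (2 * pi * barnes_value a b d e)"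
    using barnes_recurrence_pochhammer[OF pos, of n] unfolding large
    by (simp only: mult_ac)
  then show ?thesis using nz by simp
qed


section \<open>Expansion in powers of \<open>z - z0\<close>\<close>

text \<open>The modulus of (s choose k) is at most (|s|)_k / k!, the k-th coefficient of (1 -
  r)^(-|s|). For r <= 1/3 the inequality - ln(1 - r) <= r / (1 - r) <= 1/2 gives the bound; this is
  the origin of the radius 1/3 below.\<close>

lemma gbinomial_partial_sum_le:
  fixes s :: complex and r :: real
  assumes "0 \<le> r" "r \<le> 1/3"
  shows "(\<Sum>k<n. norm (s gchoose k) * r ^ k) \<le> exp (norm s / 2)"
proof -
  have sums: "(\<lambda>k. ((- norm s) gchoose k) * (- r) ^ k) sums (1 + - r) powr (- norm s)"
    using assms by (intro gen_binomial_real) auto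
  have eq: "((- norm s) gchoose k) * (- r) ^ k = pochhammer (norm s) k / fact k * r ^ k" for k
  proof -
    have "(- 1) ^ k * (- r) ^ k = r ^ k" by (simp flip: power_mult_distrib)
    then show ?thesis by (simp add: gbinomial_pochhammer mult_ac)
  qed
  have le: "norm (s gchoose k) * r ^ k \<le> pochhammer (norm s) k / fact k * r ^ k" for k
  proof -
    have "norm (pochhammer (- s) k) \<le> pochhammer (norm s) k"
    proof -
      have "norm (- s + of_nat j) \<le> norm s + real j" for j
        using norm_triangle_ineq[of "- s" "of_nat j"] by simp
      then show ?thesis
        by (simp add: pochhammer_prod prod_norm[symmetric] prod_mono)
    qed
    then show ?thesis using assms
      by (intro mult_right_mono) (auto simp: gbinomial_pochhammer norm_divide norm_mult norm_power divide_right_mono)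
  qed
  have "(\<Sum>k<n. norm (s gchoose k) * r ^ k) \<le> (\<Sum>k<n. pochhammer (norm s) k / fact k * r ^ k)"
    by (intro sum_mono le)
  also have "\<dots> \<le> (\<Sum>k. pochhammer (norm s) k / fact k * r ^ k)"
    using sums assms(1) unfolding eq
    by (intro sum_le_suminf) (auto simp: sums_iff pochhammer_prod intro!: mult_nonneg_nonneg divide_nonneg_nonneg prod_nonneg)
  also have "\<dots> = (1 + - r) powr (- norm s)"
    using sums unfolding eq by (simp only: sums_iff)
  also have "\<dots> \<le> exp (norm s / 2)"
  proof -
    have "ln (1 / (1 - r)) \<le> 1 / (1 - r) - 1"
      using assms by (intro ln_le_minus_one) auto
    also have "\<dots> \<le> 1 / 2" using assms by (simp add: field_simps)
    finally have "- ln (1 - r) \<le> 1 / 2" using assms by (simp add: ln_div)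
    then have "norm s * (- ln (1 - r)) \<le> norm s * (1 / 2)"
      by (intro mult_left_mono) auto
    then show ?thesis using assms by (simp add: powr_def)
  qed
  finally show ?thesis .
qed

lemma norm_powr_strip_le:
  assumes "z \<noteq> 0" "\<bar>Re s\<bar> \<le> A"
  shows "norm (z powr s) \<le> exp (A * \<bar>ln (norm z)\<bar>) * exp (13/4 * \<bar>Im s\<bar>)"
proof -
  \<comment> \<open>A rational bound for pi, close enough that adding the 1/2 of the binomial
    majorant stays below the rate 4 of the kernel.\<close>
  have "\<bar>Im (Ln z)\<bar> \<le> 13/4"
    using mpi_less_Im_Ln[OF assms(1)] Im_Ln_le_pi[OF assms(1)] pi_approx by auto
  have "Re s * ln (norm z) \<le> \<bar>Re s\<bar> * \<bar>ln (norm z)\<bar>"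
    by (metis abs_ge_self abs_mult)
  also have "\<dots> \<le> A * \<bar>ln (norm z)\<bar>"
    using assms(2) by (intro mult_right_mono) auto
  finally have 1: "Re s * ln (norm z) \<le> A * \<bar>ln (norm z)\<bar>" .
  have "- (Im s * Im (Ln z)) \<le> \<bar>Im s\<bar> * \<bar>Im (Ln z)\<bar>"
    by (metis abs_ge_minus_self abs_mult)
  also have "\<dots> \<le> \<bar>Im s\<bar> * (13/4)"
    using \<open>\<bar>Im (Ln z)\<bar> \<le> 13/4\<close> by (intro mult_left_mono) auto
  finally have "Re (s * Ln z) \<le> A * \<bar>ln (norm z)\<bar> + 13/4 * \<bar>Im s\<bar>"
    using 1 assms(1) by simp
  then show ?thesis using assms(1)
    by (simp add: powr_def flip: exp_add)
qed

text \<open>The first bound serves the coefficient integrals, the second the dominating function of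
  the series. The factor 3^k comes from isolating one term of
  \<open>gbinomial_partial_sum_le\<close> at r = 1/3.\<close>

lemma norm_binomial_powr_strip_le:
  assumes "z \<noteq> 0" "\<bar>Re s\<bar> \<le> A"
  shows "norm ((s gchoose k) * z powr s) \<le> 3 ^ k * exp (A / 2 + A * \<bar>ln (norm z)\<bar>) * exp (15/4 * \<bar>Im s\<bar>)"
    and "exp (norm s / 2) * norm (z powr s) \<le> exp (A / 2 + A * \<bar>ln (norm z)\<bar>) * exp (15/4 * \<bar>Im s\<bar>)"
proof -
  have "norm s \<le> A + \<bar>Im s\<bar>" using cmod_le[of s] assms(2) by linarith
  then have "exp (norm s / 2) \<le> exp (A / 2) * exp (1/2 * \<bar>Im s\<bar>)"
    by (simp flip: exp_add add: field_simps)
  then have "exp (norm s / 2) * norm (z powr s) \<le> (exp (A / 2) * exp (1/2 * \<bar>Im s\<bar>)) * (exp (A * \<bar>ln (norm z)\<bar>) * exp (13/4 * \<bar>Im s\<bar>))"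
    using norm_powr_strip_le[OF assms] by (intro mult_mono) auto
  also have "\<dots> = exp (A / 2 + A * \<bar>ln (norm z)\<bar>) * exp (15/4 * \<bar>Im s\<bar>)"
    by (simp flip: exp_add add: field_simps)
  finally show *: "exp (norm s / 2) * norm (z powr s) \<le> exp (A / 2 + A * \<bar>ln (norm z)\<bar>) * exp (15/4 * \<bar>Im s\<bar>)" .
  have "norm (s gchoose k) * (1/3) ^ k \<le> (\<Sum>j<Suc k. norm (s gchoose j) * (1/3) ^ j)"
    by (rule member_le_sum) auto
  also have "\<dots> \<le> exp (norm s / 2)" by (rule gbinomial_partial_sum_le) auto
  finally have "norm (s gchoose k) \<le> 3 ^ k * exp (norm s / 2)"
    by (simp add: field_simps)
  then have "norm ((s gchoose k) * z powr s) \<le> 3 ^ k * (exp (norm s / 2) * norm (z powr s))"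
    by (auto simp: norm_mult simp flip: mult.assoc intro: mult_right_mono)
  also have "\<dots> \<le> 3 ^ k * (exp (A / 2 + A * \<bar>ln (norm z)\<bar>) * exp (15/4 * \<bar>Im s\<bar>))"
    using * by (intro mult_left_mono) auto
  finally show "norm ((s gchoose k) * z powr s) \<le> 3 ^ k * exp (A / 2 + A * \<bar>ln (norm z)\<bar>) * exp (15/4 * \<bar>Im s\<bar>)"
    by simp
qed

lemma strip_decay_kernel_binomial:
  assumes "z \<noteq> 0"
  shows "strip_decay (\<lambda>s. barnes_kernel a b d e s * ((s gchoose k) * z powr s))"
  using norm_binomial_powr_strip_le(1)[OF assms] by (intro strip_decay_kernel_mult) blast

lemma strip_decay_kernel_powr:
  assumes "z \<noteq> 0"
  shows "strip_decay (\<lambda>s. barnes_kernel a b d e s * z powr s)"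
  using strip_decay_kernel_binomial[OF assms, of a b d e 0] by simp

lemma strip_decay_kernel_majorant:
  assumes "z \<noteq> 0"
  shows "strip_decay (\<lambda>s. barnes_kernel a b d e s * (of_real (exp (norm s / 2)) * z powr s))"
  using norm_binomial_powr_strip_le(2)[OF assms] by (intro strip_decay_kernel_mult) (auto simp: norm_mult)

lemma holomorphic_gbinomial [holomorphic_intros]: "(\<lambda>s. s gchoose k) holomorphic_on S"
  unfolding gbinomial_prod_rev by (intro holomorphic_intros) auto

lemma continuous_on_powr_right:
  assumes "z \<noteq> (0 :: complex)"
  shows "continuous_on S (\<lambda>s. z powr s)"
  by (intro holomorphic_on_imp_continuous_on holomorphic_intros)

text \<open>Dominated convergence: the modulus of the kernel times exp(|s|/2) |z0^s| majorizes all
  partial sums. The assumption on z isolates the question of branches, which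
  \<open>powr_near\<close> settles.\<close>

lemma vertical_binomial_expansion:
  fixes z z0 w :: complex
  assumes cont: "continuous_on {s. Re s = \<sigma>} (barnes_kernel a b d e)"
    and z0: "z0 \<noteq> 0" and w: "norm w \<le> 1/3"
    and z: "\<And>s. z powr s = (1 + w) powr s * z0 powr s"
  shows "(\<lambda>k. vertical_integral \<sigma> (\<lambda>s. barnes_kernel a b d e s * ((s gchoose k) * z0 powr s)) * w ^ k)
           sums vertical_integral \<sigma> (\<lambda>s. barnes_kernel a b d e s * z powr s)"
proof -
  let ?K = "barnes_kernel a b d e"
  let ?s = "\<lambda>t. Complex \<sigma> t"
  let ?c = "\<lambda>k s. ?K s * ((s gchoose k) * z0 powr s)"
  let ?F = "\<lambda>n t. \<Sum>k<n. ?c k (?s t) * w ^ k"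
  have "vertical_integrable \<sigma> (?c k)" for k
    by (intro vertical_integrableI strip_decay_kernel_binomial z0 continuous_on_mult cont
        continuous_on_powr_right holomorphic_on_imp_continuous_on[OF holomorphic_gbinomial])
  then have intc: "(\<lambda>t. ?c k (?s t)) integrable_on UNIV" for k
    unfolding vertical_integrable_def .
  then have intF: "?F n integrable_on UNIV" for n
    by (intro integrable_sum integrable_on_mult_left) auto
  have "vertical_integrable \<sigma> (\<lambda>s. of_real (norm (?K s * (of_real (exp (norm s / 2)) * z0 powr s))))"
  proof (rule vertical_integrableI)
    show "strip_decay (\<lambda>s. of_real (norm (?K s * (of_real (exp (norm s / 2)) * z0 powr s))))"
      using strip_decay_kernel_majorant[OF z0, of a b d e] unfolding strip_decay_def by simp
    show "continuous_on {s. Re s = \<sigma>} (\<lambda>s. complex_of_real (norm (?K s * (of_real (exp (norm s / 2)) * z0 powr s))))"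
      by (intro continuous_intros cont continuous_on_powr_right z0) auto
  qed
  then have inth: "(\<lambda>t. norm (?K (?s t) * (of_real (exp (norm (?s t) / 2)) * z0 powr (?s t)))) integrable_on UNIV"
    unfolding vertical_integrable_def using integrable_component[of _ UNIV 1] by fastforce
  have bound: "norm (?F n t) \<le> norm (?K (?s t) * (of_real (exp (norm (?s t) / 2)) * z0 powr (?s t)))" for n t
  proof -
    have "norm (?F n t) \<le> (\<Sum>k<n. norm (?c k (?s t) * w ^ k))" by (rule norm_sum)
    also have "\<dots> = norm (?K (?s t)) * norm (z0 powr (?s t)) * (\<Sum>k<n. norm (?s t gchoose k) * norm w ^ k)"
      by (simp add: norm_mult norm_power sum_distrib_left mult_ac)
    also have "\<dots> \<le> norm (?K (?s t)) * norm (z0 powr (?s t)) * exp (norm (?s t) / 2)"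
      using w by (intro mult_left_mono gbinomial_partial_sum_le) auto
    finally show ?thesis by (simp add: norm_mult mult_ac)
  qed
  have lim: "(\<lambda>n. ?F n t) \<longlonglongrightarrow> ?K (?s t) * z powr (?s t)" for t
  proof -
    have "(\<lambda>k. (?s t gchoose k) * w ^ k) sums (1 + w) powr (?s t)"
      using w by (intro gen_binomial_complex) auto
    then have "(\<lambda>k. (?K (?s t) * z0 powr (?s t)) * ((?s t gchoose k) * w ^ k)) sums
        ((?K (?s t) * z0 powr (?s t)) * (1 + w) powr (?s t))"
      by (rule sums_mult)
    then show ?thesis by (simp add: sums_def z mult_ac)
  qed
  have "(\<lambda>n. integral UNIV (?F n)) \<longlonglongrightarrow> integral UNIV (\<lambda>t. ?K (?s t) * z powr (?s t))"
    by (rule dominated_convergence(2)[OF intF inth bound lim])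
  moreover have "integral UNIV (?F n) = (\<Sum>k<n. vertical_integral \<sigma> (?c k) * w ^ k)" for n
    unfolding vertical_integral_def using intc
    by (subst integral_sum) (auto intro!: integrable_on_mult_left)
  ultimately show ?thesis unfolding sums_def vertical_integral_def by simp
qed

text \<open>The principal power is multiplicative while the two arguments add up to less than pi in
  modulus; off the cut, z0 leaves the margin pi - |Im (Ln z0)| for the argument of 1 + w.\<close>

lemma powr_near:
  fixes z0 :: complex
  assumes z0: "z0 \<notin> \<real>\<^sub>\<le>\<^sub>0"
  shows "\<exists>r>0. \<forall>z\<in>ball z0 r. z \<noteq> 0 \<and> norm ((z - z0) / z0) \<le> 1/3 \<and>
           (\<forall>s. z powr s = (1 + (z - z0) / z0) powr s * z0 powr s)"
proof -
  have z00: "z0 \<noteq> 0" using z0 by auto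
  have gap: "0 < pi - \<bar>Im (Ln z0)\<bar>"
    using Im_Ln_less_pi[OF z0] mpi_less_Im_Ln[OF z00] by auto
  have "isCont Ln 1" by (intro continuous_intros) auto
  then obtain \<delta> where \<delta>: "\<delta> > 0" "\<And>u. dist u 1 < \<delta> \<Longrightarrow> dist (Ln u) (Ln 1) < pi - \<bar>Im (Ln z0)\<bar>"
    using gap unfolding continuous_at_eps_delta by blast
  define r where "r = min (1/3) \<delta> * norm z0"
  have "z \<noteq> 0 \<and> norm ((z - z0) / z0) \<le> 1/3 \<and> (\<forall>s. z powr s = (1 + (z - z0) / z0) powr s * z0 powr s)"
    if "z \<in> ball z0 r" for z
  proof -
    define w where "w = (z - z0) / z0"
    have "norm (z - z0) < min (1/3) \<delta> * norm z0"
      using that by (simp add: r_def dist_norm norm_minus_commute)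
    then have w: "norm w < min (1/3) \<delta>"
      using z00 by (simp add: w_def norm_divide pos_divide_less_eq del: min_less_iff_conj)
    have nz: "1 + w \<noteq> 0"
    proof
      assume "1 + w = 0"
      then have "w = - 1" by (simp add: add_eq_0_iff)
      then show False using w by simp
    qed
    have zw: "z = (1 + w) * z0" using z00 by (simp add: w_def field_simps)
    have "norm (Ln (1 + w)) < pi - \<bar>Im (Ln z0)\<bar>"
      using \<delta>(2)[of "1 + w"] w by (simp add: dist_norm)
    then have "\<bar>Im (Ln (1 + w))\<bar> < pi - \<bar>Im (Ln z0)\<bar>"
      using abs_Im_le_cmod[of "Ln (1 + w)"] by linarith
    then have "Ln z = Ln (1 + w) + Ln z0"
      unfolding zw using nz z00 by (intro Ln_times_simple) auto
    then have "z powr s = (1 + w) powr s * z0 powr s" for s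
      using nz z00 zw by (simp add: powr_def exp_add distrib_left)
    then show ?thesis using zw nz z00 w unfolding w_def by auto
  qed
  moreover have "r > 0" using \<delta>(1) z00 by (simp add: r_def)
  ultimately show ?thesis by blast
qed

text \<open>
  The coefficients are those of the binomial series of \<open>z\<^sup>s\<close> at \<open>z0\<close>. Since this property is
  linear in \<open>\<Phi>\<close>, it passes from the kernels with shifted parameters to the original one.
\<close>

definition expandable :: "(real \<Rightarrow> complex) \<Rightarrow> (complex \<Rightarrow> complex) \<Rightarrow> bool" where
  "expandable L \<Phi> \<longleftrightarrow> (\<forall>z0. z0 \<notin> \<real>\<^sub>\<le>\<^sub>0 \<longrightarrow>
     (\<forall>k. line_integrable_on (\<lambda>s. \<Phi> s * ((s gchoose k) * z0 powr s)) L) \<and>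
     (\<exists>r>0. \<forall>z\<in>ball z0 r. line_integrable_on (\<lambda>s. \<Phi> s * z powr s) L \<and>
        (\<lambda>k. line_integral L (\<lambda>s. \<Phi> s * ((s gchoose k) * z0 powr s)) * ((z - z0) / z0) ^ k)
          sums line_integral L (\<lambda>s. \<Phi> s * z powr s)))"

text \<open>The relation between the kernels is asked for only on \<open>L\<close>, since the
  functional equations behind it can fail at poles of Gamma.\<close>

lemma line_integral_combine:
  assumes "\<And>t. q * \<Phi> (L t) = \<Phi>1 (L t) + \<Phi>2 (L t)" "q \<noteq> 0"
    and "line_integrable_on (\<lambda>s. \<Phi>1 s * m s) L" "line_integrable_on (\<lambda>s. \<Phi>2 s * m s) L"
  shows "line_integrable_on (\<lambda>s. \<Phi> s * m s) L"
    and "line_integral L (\<lambda>s. \<Phi> s * m s)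
          = (line_integral L (\<lambda>s. \<Phi>1 s * m s) + line_integral L (\<lambda>s. \<Phi>2 s * m s)) / q"
proof -
  let ?f = "\<lambda>\<Phi> t. \<Phi> (L t) * m (L t) * vector_derivative L (at t)"
  have "\<Phi> (L t) = (1 / q) * (\<Phi>1 (L t) + \<Phi>2 (L t))" for t
    using assms(1)[of t] assms(2) by (simp add: field_simps)
  then have eq: "?f \<Phi> = (\<lambda>t. (1 / q) * (?f \<Phi>1 t + ?f \<Phi>2 t))"
    by (simp add: algebra_simps add_divide_distrib)
  have "((\<lambda>t. (1 / q) * (?f \<Phi>1 t + ?f \<Phi>2 t)) has_integral
      (1 / q) * (integral UNIV (?f \<Phi>1) + integral UNIV (?f \<Phi>2))) UNIV"
    using assms(3,4) unfolding line_integrable_on_def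
    by (intro has_integral_mult_right has_integral_add integrable_integral)
  then have *: "(?f \<Phi> has_integral (1 / q) * (integral UNIV (?f \<Phi>1) + integral UNIV (?f \<Phi>2))) UNIV"
    by (simp only: eq)
  then show "line_integrable_on (\<lambda>s. \<Phi> s * m s) L"
    unfolding line_integrable_on_def by (rule has_integral_integrable)
  show "line_integral L (\<lambda>s. \<Phi> s * m s)
          = (line_integral L (\<lambda>s. \<Phi>1 s * m s) + line_integral L (\<lambda>s. \<Phi>2 s * m s)) / q"
    using integral_unique[OF *] unfolding line_integral_def by simp
qed

lemma expandable_combine:
  assumes eq: "\<And>t. q * \<Phi> (L t) = \<Phi>1 (L t) + \<Phi>2 (L t)" "q \<noteq> 0"
    and "expandable L \<Phi>1" "expandable L \<Phi>2"
  shows "expandable L \<Phi>"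
  unfolding expandable_def
proof (intro allI impI)
  fix z0 :: complex assume z0: "z0 \<notin> \<real>\<^sub>\<le>\<^sub>0"
  let ?c = "\<lambda>\<Phi> k s. \<Phi> s * ((s gchoose k) * z0 powr s)"
  let ?S = "\<lambda>\<Phi> z. line_integrable_on (\<lambda>s. \<Phi> s * z powr s) L \<and>
      (\<lambda>k. line_integral L (?c \<Phi> k) * ((z - z0) / z0) ^ k) sums line_integral L (\<lambda>s. \<Phi> s * z powr s)"
  obtain r1 where 1: "\<And>k. line_integrable_on (?c \<Phi>1 k) L" "r1 > 0" "\<And>z. z \<in> ball z0 r1 \<Longrightarrow> ?S \<Phi>1 z"
    using assms(3) z0 unfolding expandable_def by meson
  obtain r2 where 2: "\<And>k. line_integrable_on (?c \<Phi>2 k) L" "r2 > 0" "\<And>z. z \<in> ball z0 r2 \<Longrightarrow> ?S \<Phi>2 z"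
    using assms(4) z0 unfolding expandable_def by meson
  note comb = line_integral_combine[where L = L and \<Phi> = \<Phi> and ?\<Phi>1.0 = \<Phi>1 and ?\<Phi>2.0 = \<Phi>2, OF eq]
  have "?S \<Phi> z" if "z \<in> ball z0 (min r1 r2)" for z
  proof -
    have z: "?S \<Phi>1 z" "?S \<Phi>2 z" using that 1(3)[of z] 2(3)[of z] by auto
    then have "(\<lambda>k. (line_integral L (?c \<Phi>1 k) * ((z - z0) / z0) ^ k + line_integral L (?c \<Phi>2 k) * ((z - z0) / z0) ^ k) / q)
        sums ((line_integral L (\<lambda>s. \<Phi>1 s * z powr s) + line_integral L (\<lambda>s. \<Phi>2 s * z powr s)) / q)"
      by (intro sums_divide sums_add) auto
    moreover have "(line_integral L (?c \<Phi>1 k) * ((z - z0) / z0) ^ k + line_integral L (?c \<Phi>2 k) * ((z - z0) / z0) ^ k) / q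
       = line_integral L (?c \<Phi> k) * ((z - z0) / z0) ^ k" for k
      by (simp only: comb(2)[OF 1(1) 2(1)] distrib_right times_divide_eq_left)
    ultimately show ?thesis using z comb[of "\<lambda>s. z powr s"] by simp
  qed
  then show "(\<forall>k. line_integrable_on (?c \<Phi> k) L) \<and> (\<exists>r>0. \<forall>z\<in>ball z0 r. ?S \<Phi> z)"
    using comb(1)[OF 1(1) 2(1)] 1(2) 2(2) by (intro conjI allI exI[of _ "min r1 r2"]) auto
qed

section \<open>Barnes' first lemma and the expansion along the given path\<close>

definition barnes_contour :: "(real \<Rightarrow> complex) \<Rightarrow> complex \<Rightarrow> complex \<Rightarrow> complex \<Rightarrow> complex \<Rightarrow> bool" where
  "barnes_contour L a b d e \<longleftrightarrow> deformed_imag_axis L \<and>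
     (\<forall>n. left_of L (- a - of_nat n) \<and> left_of L (- b - of_nat n) \<and>
          right_of L (d + of_nat n) \<and> right_of L (e + of_nat n))"

lemma barnes_contour_sym:
  assumes "barnes_contour L a b d e"
  shows "barnes_contour L b a d e" "barnes_contour L a b e d"
  using assms unfolding barnes_contour_def by auto

text \<open>Raising a parameter only drops poles from the prescribed lists, so one and the same path
  serves throughout the induction.\<close>

lemma barnes_contour_shift:
  assumes "barnes_contour L a b d e"
  shows "barnes_contour L (a + 1) b d e" "barnes_contour L a b d (e + of_nat m)"
proof -
  have "left_of L (- (a + 1) - of_nat n)" for n
  proof -
    have "- (a + 1) - of_nat n = - a - of_nat (Suc n)" by simp
    then show ?thesis using assms unfolding barnes_contour_def by metis
  qed
  then show "barnes_contour L (a + 1) b d e"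
    using assms unfolding barnes_contour_def by auto
  have "right_of L (e + of_nat m + of_nat n)" for n
  proof -
    have "e + of_nat m + of_nat n = e + of_nat (m + n)" by simp
    then show ?thesis using assms unfolding barnes_contour_def by metis
  qed
  then show "barnes_contour L a b d (e + of_nat m)"
    using assms unfolding barnes_contour_def by auto
qed

lemma left_of_not_on: "left_of L p \<Longrightarrow> p \<notin> range L"
  unfolding left_of_def eventually_at_bot_linorder using connected_component_in by blast

lemma right_of_not_on: "right_of L p \<Longrightarrow> p \<notin> range L"
  unfolding right_of_def eventually_at_top_linorder using connected_component_in by blast

lemma nonpos_Int_add_iff: "u + s \<in> \<int>\<^sub>\<le>\<^sub>0 \<longleftrightarrow> (\<exists>n. s = - u - of_nat n)" for u s :: complex
proof
  assume "u + s \<in> \<int>\<^sub>\<le>\<^sub>0"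
  then obtain n where n: "u + s = - of_nat n" by (auto elim!: nonpos_Ints_cases')
  have "s = (u + s) - u" by simp
  also have "\<dots> = - u - of_nat n" unfolding n by simp
  finally show "\<exists>n. s = - u - of_nat n" by blast
qed auto

lemma nonpos_Int_diff_iff: "u - s \<in> \<int>\<^sub>\<le>\<^sub>0 \<longleftrightarrow> (\<exists>n. s = u + of_nat n)" for u s :: complex
proof
  assume "u - s \<in> \<int>\<^sub>\<le>\<^sub>0"
  then obtain n where n: "u - s = - of_nat n" by (auto elim!: nonpos_Ints_cases')
  have "s = u - (u - s)" by simp
  also have "\<dots> = u + of_nat n" unfolding n by simp
  finally show "\<exists>n. s = u + of_nat n" by blast
qed auto

lemma barnes_contour_avoids:
  assumes "barnes_contour L a b d e"
  shows "a + L t \<notin> \<int>\<^sub>\<le>\<^sub>0" "b + L t \<notin> \<int>\<^sub>\<le>\<^sub>0" "d - L t \<notin> \<int>\<^sub>\<le>\<^sub>0" "e - L t \<notin> \<int>\<^sub>\<le>\<^sub>0"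
  using assms unfolding barnes_contour_def nonpos_Int_add_iff nonpos_Int_diff_iff
  by (metis left_of_not_on right_of_not_on rangeI)+

text \<open>The expansion and Barnes' first lemma are bundled because the same linear relation
  between kernels transfers both.\<close>

definition barnes_property :: "(real \<Rightarrow> complex) \<Rightarrow> complex \<Rightarrow> complex \<Rightarrow> complex \<Rightarrow> complex \<Rightarrow> bool" where
  "barnes_property L a b d e \<longleftrightarrow> expandable L (barnes_kernel a b d e) \<and>
     line_integrable_on (barnes_kernel a b d e) L \<and>
     line_integral L (barnes_kernel a b d e) = 2 * pi * \<i> * barnes_value a b d e"

lemma barnes_kernel_sym:
  "barnes_kernel b a d e = barnes_kernel a b d e" "barnes_kernel a b e d = barnes_kernel a b d e"
  unfolding barnes_kernel_def by (simp_all add: fun_eq_iff mult_ac)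

lemma barnes_value_sym:
  "barnes_value b a d e = barnes_value a b d e" "barnes_value a b e d = barnes_value a b d e"
  unfolding barnes_value_def by (simp_all add: add_ac mult_ac)

lemma barnes_property_sym:
  "barnes_property L b a d e = barnes_property L a b d e"
  "barnes_property L a b e d = barnes_property L a b d e"
  unfolding barnes_property_def by (simp_all only: barnes_kernel_sym barnes_value_sym)

text \<open>The values obey the same relation as the kernels: after removal of common factors it
  reduces to (a + e) + (b + d) = a + b + d + e.\<close>

lemma barnes_property_step:
  assumes C: "barnes_contour L a b d e" and q: "a + d \<notin> \<int>\<^sub>\<le>\<^sub>0"
    and np: "a + e \<notin> \<int>\<^sub>\<le>\<^sub>0" "b + d \<notin> \<int>\<^sub>\<le>\<^sub>0"
    and P: "barnes_property L (a + 1) b d e" "barnes_property L a b (d + 1) e"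
  shows "barnes_property L a b d e"
proof -
  have q0: "a + d \<noteq> 0" using q by auto
  have eq: "(a + d) * barnes_kernel a b d e (L t)
      = barnes_kernel (a + 1) b d e (L t) + barnes_kernel a b (d + 1) e (L t)" for t
  proof -
    have G: "Gamma (a + 1 + L t) = (a + L t) * Gamma (a + L t)" "Gamma (d + 1 - L t) = (d - L t) * Gamma (d - L t)"
      using Gamma_plus1[OF barnes_contour_avoids(1)[OF C]] Gamma_plus1[OF barnes_contour_avoids(3)[OF C]]
      by (simp_all add: algebra_simps)
    show ?thesis unfolding barnes_kernel_def G by (simp add: algebra_simps)
  qed
  have "expandable L (barnes_kernel a b d e)"
    using P unfolding barnes_property_def
    by (intro expandable_combine[where L = L and q = "a + d" and \<Phi> = "barnes_kernel a b d e"
          and ?\<Phi>1.0 = "barnes_kernel (a + 1) b d e" and ?\<Phi>2.0 = "barnes_kernel a b (d + 1) e", OF eq q0]) simp_all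
  moreover have "line_integrable_on (barnes_kernel a b d e) L"
      "line_integral L (barnes_kernel a b d e)
        = (2 * pi * \<i> * barnes_value (a + 1) b d e + 2 * pi * \<i> * barnes_value a b (d + 1) e) / (a + d)"
    using line_integral_combine[where q = "a + d" and L = L and \<Phi> = "barnes_kernel a b d e" and m = "\<lambda>_. 1"
        and ?\<Phi>1.0 = "barnes_kernel (a + 1) b d e" and ?\<Phi>2.0 = "barnes_kernel a b (d + 1) e", OF eq q0] P
    unfolding barnes_property_def by simp_all
  moreover have sum: "barnes_value (a + 1) b d e + barnes_value a b (d + 1) e = (a + d) * barnes_value a b d e"
  proof -
    have G: "Gamma (a + 1 + d) = (a + d) * Gamma (a + d)" "Gamma (a + 1 + e) = (a + e) * Gamma (a + e)"
      "Gamma (a + (d + 1)) = (a + d) * Gamma (a + d)" "Gamma (b + (d + 1)) = (b + d) * Gamma (b + d)"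
      using Gamma_plus1[OF q] Gamma_plus1[OF np(1)] Gamma_plus1[OF np(2)] by (simp_all add: add_ac)
    have r: "a + 1 + b + d + e = a + b + d + e + 1" "a + b + (d + 1) + e = a + b + d + e + 1"
      by simp_all
    show ?thesis unfolding barnes_value_def G r rGamma_plus1[of "a + b + d + e", symmetric]
      by (simp add: algebra_simps)
  qed
  have "(2 * pi * \<i> * barnes_value (a + 1) b d e + 2 * pi * \<i> * barnes_value a b (d + 1) e) / (a + d)
      = 2 * pi * \<i> * barnes_value a b d e"
    unfolding distrib_left[symmetric] sum using q0 by simp
  ultimately show ?thesis unfolding barnes_property_def by simp
qed

lemma closed_nonpos_Int_shift:
  "closed {s :: complex. u + s \<in> \<int>\<^sub>\<le>\<^sub>0}" "closed {s :: complex. u - s \<in> \<int>\<^sub>\<le>\<^sub>0}"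
proof -
  have cl: "closed (\<int>\<^sub>\<le>\<^sub>0 :: complex set)" by (rule closed_subset_Ints) (auto elim!: nonpos_Ints_cases)
  from continuous_closed_vimage[OF cl, of "\<lambda>s. u + s"] continuous_closed_vimage[OF cl, of "\<lambda>s. u - s"]
  show "closed {s :: complex. u + s \<in> \<int>\<^sub>\<le>\<^sub>0}" "closed {s :: complex. u - s \<in> \<int>\<^sub>\<le>\<^sub>0}"
    by (auto simp: vimage_def)
qed

lemma barnes_property_base:
  assumes C: "barnes_contour L a b d e"
    and pos: "0 < Re (a + d)" "0 < Re (a + e)" "0 < Re (b + d)" "0 < Re (b + e)"
  shows "barnes_property L a b d e"
proof -
  let ?K = "barnes_kernel a b d e"
  \<comment> \<open>The midpoint of a nonempty gap: the four positivity conditions say that the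
    larger of - Re a, - Re b lies below the smaller of Re d, Re e.\<close>
  define \<sigma> where "\<sigma> = (max (- Re a) (- Re b) + min (Re d) (Re e)) / 2"
  have \<sigma>: "- Re a < \<sigma>" "- Re b < \<sigma>" "\<sigma> < Re d" "\<sigma> < Re e"
    using pos by (auto simp: \<sigma>_def max_def min_def)
  define PL where "PL = {s. a + s \<in> \<int>\<^sub>\<le>\<^sub>0} \<union> {s. b + s \<in> \<int>\<^sub>\<le>\<^sub>0}"
  define PR where "PR = {s. d - s \<in> \<int>\<^sub>\<le>\<^sub>0} \<union> {s. e - s \<in> \<int>\<^sub>\<le>\<^sub>0}"
  have cl: "closed (PL \<union> PR)"
    unfolding PL_def PR_def by (intro closed_Un closed_nonpos_Int_shift)
  have PL: "left_of L p \<and> Re p < \<sigma> \<and> \<bar>Im p\<bar> \<le> max \<bar>Im a\<bar> \<bar>Im b\<bar>" if "p \<in> PL" for p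
    using that C \<sigma> unfolding PL_def nonpos_Int_add_iff barnes_contour_def by auto
  have PR: "right_of L p \<and> \<sigma> < Re p \<and> \<bar>Im p\<bar> \<le> max \<bar>Im d\<bar> \<bar>Im e\<bar>" if "p \<in> PR" for p
    using that C \<sigma> unfolding PR_def nonpos_Int_diff_iff barnes_contour_def by auto
  have D: "deformed_imag_axis L" using C unfolding barnes_contour_def by blast
  have im: "\<bar>Im p\<bar> \<le> max (max \<bar>Im a\<bar> \<bar>Im b\<bar>) (max \<bar>Im d\<bar> \<bar>Im e\<bar>)" if "p \<in> PL \<union> PR" for p
    using that PL[of p] PR[of p] by (auto simp: le_max_iff_disj)
  have PL': "left_of L p \<and> Re p < \<sigma>" if "p \<in> PL" for p using PL[OF that] by blast
  have PR': "right_of L p \<and> \<sigma> < Re p" if "p \<in> PR" for p using PR[OF that] by blast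
  have move: "line_integrable_on (\<lambda>s. ?K s * m s) L"
      "line_integral L (\<lambda>s. ?K s * m s) = \<i> * vertical_integral \<sigma> (\<lambda>s. ?K s * m s)"
    if "m holomorphic_on UNIV" "strip_decay (\<lambda>s. ?K s * m s)" for m
  proof -
    have "(\<lambda>s. ?K s * m s) holomorphic_on - (PL \<union> PR)"
      using that(1) unfolding PL_def PR_def
      by (intro holomorphic_on_mult holomorphic_barnes_kernel) (auto elim: holomorphic_on_subset)
    from line_integral_eq_vertical[OF D cl im PL' PR' this that(2)]
    show "line_integrable_on (\<lambda>s. ?K s * m s) L"
      "line_integral L (\<lambda>s. ?K s * m s) = \<i> * vertical_integral \<sigma> (\<lambda>s. ?K s * m s)"
      by blast+
  qed
  have contK: "continuous_on {s. Re s = \<sigma>} ?K"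
    using \<sigma> by (intro holomorphic_on_imp_continuous_on holomorphic_barnes_kernel)
      (auto intro!: Re_pos_not_nonpos_Int)
  have "expandable L ?K"
    unfolding expandable_def
  proof (intro allI impI conjI)
    fix z0 :: complex assume z0: "z0 \<notin> \<real>\<^sub>\<le>\<^sub>0"
    then have z00: "z0 \<noteq> 0" by auto
    have b: "line_integrable_on (\<lambda>s. ?K s * ((s gchoose k) * z0 powr s)) L"
        "line_integral L (\<lambda>s. ?K s * ((s gchoose k) * z0 powr s))
          = \<i> * vertical_integral \<sigma> (\<lambda>s. ?K s * ((s gchoose k) * z0 powr s))" for k
      by (intro move strip_decay_kernel_binomial z00 holomorphic_intros)+
    show "line_integrable_on (\<lambda>s. ?K s * ((s gchoose k) * z0 powr s)) L" for k by (rule b)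
    obtain r where r: "r > 0" "\<And>z. z \<in> ball z0 r \<Longrightarrow> z \<noteq> 0 \<and> norm ((z - z0) / z0) \<le> 1/3 \<and>
           (\<forall>s. z powr s = (1 + (z - z0) / z0) powr s * z0 powr s)"
      using powr_near[OF z0] by blast
    have "line_integrable_on (\<lambda>s. ?K s * z powr s) L \<and>
        (\<lambda>k. line_integral L (\<lambda>s. ?K s * ((s gchoose k) * z0 powr s)) * ((z - z0) / z0) ^ k)
          sums line_integral L (\<lambda>s. ?K s * z powr s)" if z: "z \<in> ball z0 r" for z
    proof -
      have p: "line_integrable_on (\<lambda>s. ?K s * z powr s) L"
        "line_integral L (\<lambda>s. ?K s * z powr s) = \<i> * vertical_integral \<sigma> (\<lambda>s. ?K s * z powr s)"
        using r(2)[OF z] by (intro move strip_decay_kernel_powr holomorphic_intros; simp)+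
      have "(\<lambda>k. vertical_integral \<sigma> (\<lambda>s. ?K s * ((s gchoose k) * z0 powr s)) * ((z - z0) / z0) ^ k)
           sums vertical_integral \<sigma> (\<lambda>s. ?K s * z powr s)"
        using r(2)[OF z] by (intro vertical_binomial_expansion contK z00) auto
      from sums_mult[OF this, of \<i>] show ?thesis
        using p(1) by (simp add: p(2) b(2) mult.assoc)
    qed
    then show "\<exists>r>0. \<forall>z\<in>ball z0 r. line_integrable_on (\<lambda>s. ?K s * z powr s) L \<and>
        (\<lambda>k. line_integral L (\<lambda>s. ?K s * ((s gchoose k) * z0 powr s)) * ((z - z0) / z0) ^ k)
          sums line_integral L (\<lambda>s. ?K s * z powr s)" using r(1) by blast
  qed
  \<comment> \<open>Moving the line to 0 shifts a, b by \<open>\<sigma>\<close> and d, e by -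
    \<open>\<sigma>\<close>, which leaves all sums in \<open>barnes_value\<close> unchanged.\<close>
  moreover have "vertical_integral \<sigma> ?K = 2 * pi * barnes_value a b d e"
    using \<sigma> unfolding vertical_integral_barnes_kernel_shift[of \<sigma>]
    by (subst barnes_first_lemma) (auto simp: barnes_value_def algebra_simps)
  ultimately show ?thesis
    using move[of "\<lambda>_. 1"] strip_decay_kernel unfolding barnes_property_def by (simp add: mult_ac)
qed

lemma plus_1_not_nonpos_Int: "x \<notin> \<int>\<^sub>\<le>\<^sub>0 \<Longrightarrow> x + 1 \<notin> \<int>\<^sub>\<le>\<^sub>0" for x :: complex
  by (metis add_diff_cancel_right' diff_add_cancel nonpos_Ints_diff_Nats Nats_1)

text \<open>Each step raises a or d, hence a + d and one more cross sum, and lowers none, so the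
  total of the four counts drops until all real parts are positive. The four conditions exclude zero
  divisors and survive adding 1; the symmetries of the kernel reduce every case to Re (a + d) <=
  0.\<close>

lemma barnes_property_contour:
  assumes "barnes_contour L a b d e"
    and "a + d \<notin> \<int>\<^sub>\<le>\<^sub>0" "a + e \<notin> \<int>\<^sub>\<le>\<^sub>0" "b + d \<notin> \<int>\<^sub>\<le>\<^sub>0" "b + e \<notin> \<int>\<^sub>\<le>\<^sub>0"
  shows "barnes_property L a b d e"
proof -
  \<comment> \<open>An upper bound for the number of unit steps needed to make the real part
    positive.\<close>
  define \<mu> where "\<mu> = (\<lambda>x. nat \<lceil>1 - Re x\<rceil>)"
  have \<mu>: "\<mu> (x + 1) \<le> \<mu> x" "Re x \<le> 0 \<Longrightarrow> \<mu> (x + 1) < \<mu> x" for x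
  proof -
    have *: "\<lceil>1 - Re (x + 1)\<rceil> = \<lceil>1 - Re x\<rceil> - 1" by simp linarith
    show "\<mu> (x + 1) \<le> \<mu> x" unfolding \<mu>_def * by simp
    have "1 \<le> \<lceil>1 - Re x\<rceil>" if "Re x \<le> 0" using that by linarith
    then show "\<mu> (x + 1) < \<mu> x" if "Re x \<le> 0" using that unfolding \<mu>_def * by linarith
  qed
  have shiftd: "barnes_contour L a b (d + 1) e" if "barnes_contour L a b d e" for a b d e
    using barnes_contour_shift(2)[OF barnes_contour_sym(2)[OF that], of 1] barnes_contour_sym(2) by simp
  have "\<forall>a b d e. \<mu> (a + d) + \<mu> (a + e) + \<mu> (b + d) + \<mu> (b + e) = n \<longrightarrow> barnes_contour L a b d e \<longrightarrow>
     a + d \<notin> \<int>\<^sub>\<le>\<^sub>0 \<longrightarrow> a + e \<notin> \<int>\<^sub>\<le>\<^sub>0 \<longrightarrow> b + d \<notin> \<int>\<^sub>\<le>\<^sub>0 \<longrightarrow> b + e \<notin> \<int>\<^sub>\<le>\<^sub>0 \<longrightarrow> barnes_property L a b d e" for n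
  proof (induction n rule: less_induct)
    case (less n)
    have step: "barnes_property L a b d e"
      if n: "\<mu> (a + d) + \<mu> (a + e) + \<mu> (b + d) + \<mu> (b + e) = n" and C: "barnes_contour L a b d e"
        and np: "a + d \<notin> \<int>\<^sub>\<le>\<^sub>0" "a + e \<notin> \<int>\<^sub>\<le>\<^sub>0" "b + d \<notin> \<int>\<^sub>\<le>\<^sub>0" "b + e \<notin> \<int>\<^sub>\<le>\<^sub>0"
        and neg: "Re (a + d) \<le> 0" for a b d e
    proof (rule barnes_property_step[OF C np(1-3)])
      have e: "a + 1 + d = a + d + 1" "a + 1 + e = a + e + 1" "a + (d + 1) = a + d + 1" "b + (d + 1) = b + d + 1"
        by simp_all
      have "\<mu> (a + 1 + d) + \<mu> (a + 1 + e) + \<mu> (b + d) + \<mu> (b + e) < n"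
        unfolding e using n \<mu>(2)[OF neg] \<mu>(1)[of "a + e"] by linarith
      then show "barnes_property L (a + 1) b d e"
        using less.IH np barnes_contour_shift(1)[OF C] plus_1_not_nonpos_Int e(1,2) by metis
      have "\<mu> (a + (d + 1)) + \<mu> (a + e) + \<mu> (b + (d + 1)) + \<mu> (b + e) < n"
        unfolding e using n \<mu>(2)[OF neg] \<mu>(1)[of "b + d"] by linarith
      then show "barnes_property L a b (d + 1) e"
        using less.IH np shiftd[OF C] plus_1_not_nonpos_Int e(3,4) by metis
    qed
    show ?case
    proof (intro allI impI)
      fix a b d e
      assume n: "\<mu> (a + d) + \<mu> (a + e) + \<mu> (b + d) + \<mu> (b + e) = n" and C: "barnes_contour L a b d e"
        and np: "a + d \<notin> \<int>\<^sub>\<le>\<^sub>0" "a + e \<notin> \<int>\<^sub>\<le>\<^sub>0" "b + d \<notin> \<int>\<^sub>\<le>\<^sub>0" "b + e \<notin> \<int>\<^sub>\<le>\<^sub>0"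
      consider "Re (a + d) \<le> 0" | "Re (a + e) \<le> 0" | "Re (b + d) \<le> 0" | "Re (b + e) \<le> 0"
        | "0 < Re (a + d)" "0 < Re (a + e)" "0 < Re (b + d)" "0 < Re (b + e)" by linarith
      then show "barnes_property L a b d e"
      proof cases
        case 1
        then show ?thesis using n C np by (intro step) auto
      next
        case 2
        then have "barnes_property L a b e d"
          by (intro step[OF _ barnes_contour_sym(2)[OF C]]) (use n np in \<open>simp_all add: add_ac\<close>)
        then show ?thesis by (simp add: barnes_property_sym(2))
      next
        case 3
        then have "barnes_property L b a d e"
          by (intro step[OF _ barnes_contour_sym(1)[OF C]]) (use n np in \<open>simp_all add: add_ac\<close>)
        then show ?thesis by (simp add: barnes_property_sym(1))
      next
        case 4
        then have "barnes_property L b a e d"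
          by (intro step[OF _ barnes_contour_sym(2)[OF barnes_contour_sym(1)[OF C]]]) (use n np in \<open>simp_all add: add_ac\<close>)
        then show ?thesis by (metis barnes_property_sym)
      next
        case 5
        with C show ?thesis by (rule barnes_property_base)
      qed
    qed
  qed
  then show ?thesis using assms by blast
qed

section \<open>Taylor coefficients, identity theorem and conclusion\<close>

lemma powser_coefficients_unique:
  fixes A B :: "nat \<Rightarrow> complex"
  assumes "0 < r" "\<And>w. norm w < r \<Longrightarrow> (\<lambda>n. A n * w ^ n) sums f w"
    and "\<And>w. norm w < r \<Longrightarrow> (\<lambda>n. B n * w ^ n) sums f w"
  shows "A = B"
proof (rule ext, rule ccontr)
  fix m assume m: "A m \<noteq> B m"
  have "(\<lambda>n. (A n - B n) * w ^ n) sums 0" if "norm w < r" for w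
    using sums_diff[OF assms(2,3)[OF that]] by (simp add: left_diff_distrib)
  note sums0 = this
  show False
  proof (cases "m = 0")
    case True
    then show False using sums0[of 0] assms(1) m by (simp add: powser_sums_zero_iff)
  next
    case False
    obtain s where "0 < s" "\<And>z. z \<in> cball 0 s - {0 :: complex} \<Longrightarrow> (0 :: complex) \<noteq> 0"
      using powser_0_nonzero[of r 0 "\<lambda>n. A n - B n" "\<lambda>_. 0" m] assms(1) sums0 m False by auto
    then show False using \<open>0 < s\<close> by (metis Diff_iff mem_cball_0 norm_of_real abs_of_pos order_refl of_real_eq_0_iff less_irrefl singletonD)
  qed
qed

lemma expandable_holomorphic:
  assumes "expandable L \<Phi>"
  shows "(\<lambda>z. line_integral L (\<lambda>s. \<Phi> s * z powr s)) holomorphic_on - \<real>\<^sub>\<le>\<^sub>0"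
proof -
  let ?I = "\<lambda>z. line_integral L (\<lambda>s. \<Phi> s * z powr s)"
  have "?I field_differentiable at z0" if "z0 \<in> - \<real>\<^sub>\<le>\<^sub>0" for z0
  proof -
    define c where "c = (\<lambda>k. line_integral L (\<lambda>s. \<Phi> s * ((s gchoose k) * z0 powr s)))"
    have "z0 \<notin> \<real>\<^sub>\<le>\<^sub>0" using that by simp
    then have "\<exists>r>0. \<forall>z\<in>ball z0 r. line_integrable_on (\<lambda>s. \<Phi> s * z powr s) L \<and>
        (\<lambda>k. c k * ((z - z0) / z0) ^ k) sums ?I z"
      using assms unfolding expandable_def c_def by (elim allE[of _ z0] impE conjE)
    then obtain r where r: "r > 0" "\<And>z. z \<in> ball z0 r \<Longrightarrow> (\<lambda>k. c k * ((z - z0) / z0) ^ k) sums ?I z"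
      by blast
    have "?I holomorphic_on ball z0 r"
      using r(2) by (intro power_series_holomorphic[where a = "\<lambda>k. c k / z0 ^ k"]) (simp add: power_divide)
    then show ?thesis
      using r(1) by (meson centre_in_ball holomorphic_on_imp_differentiable_at open_ball)
  qed
  then show ?thesis by (simp add: field_differentiable_at_within holomorphic_on_def)
qed

lemma slit_plane_reflect: "1 - z \<in> - complex_of_real ` {1..} \<longleftrightarrow> z \<notin> \<real>\<^sub>\<le>\<^sub>0"
proof -
  have "1 - z \<in> complex_of_real ` {1..} \<longleftrightarrow> z \<in> \<real>\<^sub>\<le>\<^sub>0"
  proof
    assume "1 - z \<in> complex_of_real ` {1..}"
    then obtain x where x: "x \<ge> 1" "1 - z = of_real x" by auto
    have "z = 1 - (1 - z)" by simp
    also have "\<dots> = of_real (1 - x)" unfolding x(2) by simp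
    finally show "z \<in> \<real>\<^sub>\<le>\<^sub>0" using x(1) by (simp only: nonpos_Reals_of_real_iff)
  next
    assume "z \<in> \<real>\<^sub>\<le>\<^sub>0"
    then obtain x where "z = of_real x" "x \<le> 0" by (auto elim!: nonpos_Reals_cases)
    then show "1 - z \<in> complex_of_real ` {1..}" by (intro image_eqI[of _ _ "1 - x"]) auto
  qed
  then show ?thesis by simp
qed

lemma open_slit_plane: "open (- complex_of_real ` {1::real..})"
proof -
  have "- complex_of_real ` {1::real..} = (\<lambda>w. 1 - w) -` (- \<real>\<^sub>\<le>\<^sub>0)"
    using slit_plane_reflect[of "1 - w" for w] by auto
  moreover have "open ((\<lambda>w::complex. 1 - w) -` (- \<real>\<^sub>\<le>\<^sub>0))"
    by (intro open_vimage continuous_intros) (simp add: open_Compl)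
  ultimately show ?thesis by simp
qed

text \<open>\<open>gauss_F\<close> is a choice, and f itself proves that its conditions can be met;
  the identity theorem on the connected slit plane then fixes the value. In the application the
  Barnes integral thus supplies the continuation of the Gauss series.\<close>

lemma gauss_F_eqI:
  assumes hol: "f holomorphic_on (- complex_of_real ` {1..})"
    and "\<And>w. norm w < 1 \<Longrightarrow> (\<lambda>k. pochhammer a k * pochhammer b k / (fact k * pochhammer c k) * w ^ k) sums f w"
    and "w \<in> - complex_of_real ` {1..}"
  shows "gauss_F a b c w = f w"
proof -
  let ?P = "\<lambda>f. f holomorphic_on (- complex_of_real ` {1..}) \<and>
     (\<forall>w. norm w < 1 \<longrightarrow> (\<lambda>k. pochhammer a k * pochhammer b k / (fact k * pochhammer c k) * w ^ k) sums f w)"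
  have "?P f" using assms by auto
  then have P: "?P (gauss_F a b c)" unfolding gauss_F_def by (rule someI[of ?P f])
  have sub: "ball 0 1 \<subseteq> - complex_of_real ` {1..}"
    by (auto simp: dist_norm)
  show ?thesis
  proof (rule analytic_continuation_open[where f = "gauss_F a b c" and g = f, OF open_ball open_slit_plane _ _ sub])
    show "connected (- complex_of_real ` {1..})"
      by (intro starlike_imp_connected starlike_slotted_complex_plane_right)
    show "gauss_F a b c z = f z" if "z \<in> ball 0 1" for z
    proof -
      have "norm z < 1" using that by simp
      then show ?thesis
        using sums_unique2[OF P[THEN conjunct2, rule_format] assms(2)] by blast
    qed
  qed (use P assms in auto)
qed

theorem theorem2p1:
  fixes a b c z :: complex and L :: "real \<Rightarrow> complex"
  assumes "z \<notin> \<real>\<^sub>\<le>\<^sub>0"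
    and "a \<notin> \<int>\<^sub>\<le>\<^sub>0" and "c - a \<notin> \<int>\<^sub>\<le>\<^sub>0" and "b \<notin> \<int>\<^sub>\<le>\<^sub>0" and "c - b \<notin> \<int>\<^sub>\<le>\<^sub>0" and "c \<notin> \<int>\<^sub>\<le>\<^sub>0"
    and "deformed_imag_axis L"
    and "\<And>n::nat. left_of L (- a - of_nat n)"
    and "\<And>n::nat. left_of L (- b - of_nat n)"
    and "\<And>n::nat. right_of L (of_nat n)"
    and "\<And>n::nat. right_of L (c - a - b + of_nat n)"
  shows "line_integrable_on
           (\<lambda>s. Gamma (a + s) * Gamma (b + s) * Gamma (c - a - b - s) * Gamma (- s) * z powr s) L \<and>
         Gamma a * Gamma (c - a) * Gamma b * Gamma (c - b) / Gamma c * gauss_F a b c (1 - z) =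
           1 / (2 * of_real pi * \<i>) * line_integral L
           (\<lambda>s. Gamma (a + s) * Gamma (b + s) * Gamma (c - a - b - s) * Gamma (- s) * z powr s)"
proof -
  define d where "d = c - a - b"
  \<comment> \<open>The kernel with e = k belongs to the k-th Taylor coefficient at z = 1; its poles
    k, k + 1, ... are among those for e = 0.\<close>
  have C: "barnes_contour L a b d (of_nat k)" for k
  proof -
    have "barnes_contour L a b d 0"
      unfolding barnes_contour_def d_def using assms(7-11) by simp
    from barnes_contour_shift(2)[OF this, of k] show ?thesis by simp
  qed
  \<comment> \<open>For e = 0 the cross sums are c - b, a, c - a and b, which is how the
    admissibility hypotheses enter.\<close>
  have sums_eq: "a + d = c - b" "b + d = c - a" "a + b + d + e = c + e" for e
    by (simp_all add: d_def)
  have shift_np: "x + of_nat k \<notin> \<int>\<^sub>\<le>\<^sub>0" if "x \<notin> \<int>\<^sub>\<le>\<^sub>0" for x :: complex and k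
  proof (induction k)
    case (Suc k)
    from plus_1_not_nonpos_Int[OF this] show ?case by (simp add: add_ac)
  qed (use that in simp)
  have bp: "barnes_property L a b d (of_nat k)" for k
    by (rule barnes_property_contour[OF C]) (use assms(2-5) shift_np in \<open>auto simp: sums_eq\<close>)
  define K where "K = Gamma a * Gamma (c - a) * Gamma b * Gamma (c - b) / Gamma c"
  have Knz: "K \<noteq> 0" using assms(2-6) by (simp add: K_def Gamma_eq_zero_iff)
  let ?\<Phi> = "barnes_kernel a b d 0"
  define I where "I = (\<lambda>z. line_integral L (\<lambda>s. ?\<Phi> s * z powr s))"
  let ?t = "\<lambda>k. pochhammer a k * pochhammer b k / (fact k * pochhammer c k)"
  have exp: "expandable L ?\<Phi>" using bp[of 0] unfolding barnes_property_def by simp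
  have coeff: "line_integral L (\<lambda>s. ?\<Phi> s * ((s gchoose k) * 1 powr s)) = (- 1) ^ k * (2 * pi * \<i> * K * ?t k)" for k
  proof -
    \<comment> \<open>Because (s choose k) Gamma(- s) = (- 1)^k Gamma(k - s) / k!.\<close>
    have "?\<Phi> (L t) * (L t gchoose k) = (- 1) ^ k / fact k * barnes_kernel a b d (of_nat k) (L t)" for t
    proof -
      have np: "- L t \<notin> \<int>\<^sub>\<le>\<^sub>0" using barnes_contour_avoids(4)[OF C[of 0], of t] by simp
      then have "Gamma (of_nat k - L t) = pochhammer (- L t) k * Gamma (- L t)"
        using pochhammer_Gamma[OF np, of k] by (simp add: Gamma_eq_zero_iff)
      then show ?thesis by (simp add: barnes_kernel_def gbinomial_pochhammer)
    qed
    then have "line_integral L (\<lambda>s. ?\<Phi> s * ((s gchoose k) * 1 powr s))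
        = (- 1) ^ k / fact k * line_integral L (barnes_kernel a b d (of_nat k))"
      unfolding line_integral_def by (simp add: mult.assoc)
    also have "line_integral L (barnes_kernel a b d (of_nat k)) = 2 * pi * \<i> * barnes_value a b d (of_nat k)"
      using bp[of k] unfolding barnes_property_def by simp
    also have "barnes_value a b d (of_nat k) = K * (pochhammer a k * pochhammer b k / pochhammer c k)"
    proof -
      have "Gamma (x + of_nat k) = pochhammer x k * Gamma x" if "x \<notin> \<int>\<^sub>\<le>\<^sub>0" for x :: complex
        using pochhammer_Gamma[OF that, of k] that by (simp add: Gamma_eq_zero_iff)
      then show ?thesis using assms(2,4,6)
        by (simp add: barnes_value_def sums_eq K_def rGamma_inverse_Gamma divide_inverse mult_ac)
    qed
    finally show ?thesis by (simp add: mult_ac)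
  qed
  obtain r where r: "r > 0" "\<And>z. z \<in> ball 1 r \<Longrightarrow>
      (\<lambda>k. (- 1) ^ k * (2 * pi * \<i> * K * ?t k) * (z - 1) ^ k) sums I z"
    using exp[unfolded expandable_def, rule_format, of 1] unfolding coeff I_def by auto
  define f where "f = (\<lambda>w. I (1 - w) / (2 * pi * \<i> * K))"
  have holf: "f holomorphic_on (- complex_of_real ` {1..})"
  proof -
    have "(I \<circ> (\<lambda>w. 1 - w)) holomorphic_on (- complex_of_real ` {1..})"
      using expandable_holomorphic[OF exp] slit_plane_reflect[of "1 - w" for w]
      unfolding I_def by (intro holomorphic_on_compose_gen[where t = "- \<real>\<^sub>\<le>\<^sub>0"] holomorphic_intros) auto
    then show ?thesis unfolding f_def o_def using Knz by (intro holomorphic_intros) auto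
  qed
  have local: "(\<lambda>k. ?t k * w ^ k) sums f w" if "norm w < r" for w
  proof -
    have "(\<lambda>k. (- 1) ^ k * (2 * pi * \<i> * K * ?t k) * (- w) ^ k / (2 * pi * \<i> * K)) sums f w"
      using r(2)[of "1 - w"] that unfolding f_def by (intro sums_divide) (simp add: dist_norm)
    moreover have "(- 1) ^ k * (2 * pi * \<i> * K * ?t k) * (- w) ^ k / (2 * pi * \<i> * K) = ?t k * w ^ k" for k
    proof -
      have "(- 1) ^ k * (- w) ^ k = w ^ k" by (simp flip: power_mult_distrib)
      then show ?thesis using Knz by (simp add: field_simps)
    qed
    ultimately show ?thesis by simp
  qed
  have sub: "ball 0 1 \<subseteq> - complex_of_real ` {1..}" by (auto simp: dist_norm)
  \<comment> \<open>The expansion of the integral is known only in a small disc. The Taylor series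
    of f at 0 converges in the whole unit disc, where f is holomorphic, and has the same
    coefficients.\<close>
  have taylor: "(\<lambda>k. (deriv ^^ k) f 0 / fact k * w ^ k) sums f w" if "norm w < 1" for w
    using holomorphic_power_series[OF holomorphic_on_subset[OF holf sub], of w] that by simp
  have "(\<lambda>k. (deriv ^^ k) f 0 / fact k) = ?t"
    using r(1) local taylor by (intro powser_coefficients_unique[of "min r 1" _ f]) auto
  then have global: "(\<lambda>k. ?t k * w ^ k) sums f w" if "norm w < 1" for w
    using taylor[OF that] by (simp add: fun_eq_iff)
  have "1 - z \<in> - complex_of_real ` {1..}" using assms(1) by (simp only: slit_plane_reflect simp_thms)
  with holf global have "gauss_F a b c (1 - z) = f (1 - z)" by (rule gauss_F_eqI)
  then have "K * gauss_F a b c (1 - z) = 1 / (2 * pi * \<i>) * I z"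
    using Knz by (simp add: f_def)
  \<comment> \<open>Integrability at z is the case of the centre in the expansion at z0 = z.\<close>
  moreover have "line_integrable_on (\<lambda>s. ?\<Phi> s * z powr s) L"
    using exp[unfolded expandable_def, rule_format, OF assms(1)] by (metis centre_in_ball)
  ultimately show ?thesis
    by (simp add: I_def K_def barnes_kernel_def d_def)
qed

end
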